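(* Let $\Theta$ be a finite (discrete) decision space. Let $p_k(\theta):=\mathbb{P}(\theta=\mathcal{A}(z_1,\ldots,z_k))$, $p_k^{\max}:=\max_{\theta\in\Theta}p_k(\theta)$, and for $\delta\ge 0$ let $$\eta_{k,\delta}:=p_k^{\max}-\max_{\theta\in\Theta\setminus\Theta^{\delta}}p_k(\theta),$$ where $\max_{\theta\in\Theta\setminus\Theta^{\delta}}p_k(\theta)$ is taken to be $0$ if $\Theta\setminus\Theta^\delta$ is empty. Then for every $k\le n$ and $\delta\ge 0$ such that $\eta_{k,\delta}>0$, the output $\hat\theta_n$ of the algorithm MoVE (run with base learner $\mathcal{A}$, $n$ i.i.d. observations, subsample size $k$ and ensemble size $B$) satisfies $$ \begin{aligned} \mathbb{P}\Big(L(\hat\theta_n)>\min_{\theta\in\Theta}L(\theta)+\delta\Big)\le |\Theta|\Bigg[&\exp\Big(-\frac{n}{2k}D_{\mathrm{KL}}\Big(p_k^{\max}-\frac{3\eta_{k,\delta}}{4}\Big\|p_k^{\max}-\eta_{k,\delta}\Big)\Big)+2\exp\Big(-\frac{n}{2k}D_{\mathrm{KL}}\Big(p_k^{\max}-\frac{\eta_{k,\delta}}{4}\Big\|p_k^{\max}\Big)\Big)\\ &+\exp\Big(-\frac{B}{24}\cdot\frac{\eta_{k,\delta}^2}{\min\{p_k^{\max},1-p_k^{\max}\}+3\eta_{k,\delta}/4}\Big)\\ &+\mathbf{1}\Big(p_k^{\max}+\frac{\eta_{k,\delta}}{4}\le 1\Big)\exp\Big(-\frac{n}{2k}D_{\mathrm{KL}}\Big(p_k^{\max}+\frac{\eta_{k,\delta}}{4}\Big\|p_k^{\max}\Big)-\frac{B}{24}\cdot\frac{\eta_{k,\delta}^2}{1-p_k^{\max}+\eta_{k,\delta}/4}\Big)\Bigg].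 \end{aligned} $$ In particular, there are universal constants $C_1,C_2,C_3>0$ such that, if $\eta_{k,\delta}>4/5$, the right-hand side above is further bounded by $$|\Theta|\Big(3\min\Big\{e^{-2/5},\,C_1\max\Big\{1-p_k^{\max},\ \max_{\theta\in\Theta\setminus\Theta^{\delta}}p_k(\theta)\Big\}\Big\}^{\frac{n}{C_2k}}+e^{-B/C_3}\Big).$$
   Context: Setting: $z$ is a random variable with values in $\mathcal{Z}$, $l:\Theta\times\mathcal{Z}\to\mathbb{R}$ is a cost function, and $L(\theta):=\mathbb{E}[l(\theta,z)]$ is to be minimized over $\theta\in\Theta$. $z_1,\ldots,z_n$ are i.i.d. copies of $z$. For $\delta\ge0$, $\Theta^{\delta}:=\{\theta\in\Theta:L(\theta)\le\min_{\theta'\in\Theta}L(\theta')+\delta\}$. Base learner: $\mathcal{A}(z_1,\ldots,z_k;\omega)\in\Theta$ is a learning algorithm mapping data (of any size) and algorithmic randomness $\omega$, independent of the data, to an element of $\Theta$; $\omega$ is suppressed in the notation. The probability in $p_k(\theta)$ is over $k$ i.i.d. observations and $\omega$. Algorithm MoVE: for $b=1,\ldots,B$, independently draw a subsample $(z_1^b,\ldots,z_k^b)$ uniformly from $(z_1,\ldots,z_n)$ without replacement and set $\hat\theta_k^b=\mathcal{A}(z_1^b,\ldots,z_k^b)$ (with independent algorithmic randomness for each $b$). Output $\hat\theta_n\in\arg\max_{\theta\in\Theta}\sum_{b=1}^B\mathbf{1}(\theta=\hat\theta_k^b)$, ties broken arbitrarily. $\mathbb{P}$ on the left-hand side is over data,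 subsampling and algorithmic randomness. Notation: $|\Theta|$ is the cardinality of $\Theta$; $D_{\mathrm{KL}}(p\|q):=p\ln\frac{p}{q}+(1-p)\ln\frac{1-p}{1-q}$ for $p,q\in[0,1]$ is the Kullback–Leibler divergence between Bernoulli distributions with means $p$ and $q$, with the usual conventions $0\ln 0=0\ln(0/0)=0$, $a\ln(a/0)=+\infty$ for $a>0$, and $\exp(-\infty)=0$. *)

theory Defs
  imports "HOL-Probability.Probability"
begin

definition risk :: "'z measure \<Rightarrow> ('t \<Rightarrow> 'z \<Rightarrow> real) \<Rightarrow> 't \<Rightarrow> real" where
  "risk D l \<theta> = (\<integral>z. l \<theta> z \<partial>D)"

definition near_optimal :: "'z measure \<Rightarrow> ('t \<Rightarrow> 'z \<Rightarrow> real) \<Rightarrow> 't set \<Rightarrow> real \<Rightarrow> 't set" where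
  "near_optimal D l \<Theta> \<delta> = {\<theta> \<in> \<Theta>. risk D l \<theta> \<le> (MIN \<theta>'\<in>\<Theta>. risk D l \<theta>') + \<delta>}"

text \<open>A base learner \<open>A\<close> takes a data list of any length and a draw of the algorithmic randomness,
  whose law is \<open>R\<close>.\<close>

definition learner_prob ::
  "'z measure \<Rightarrow> 'w measure \<Rightarrow> ('z list \<Rightarrow> 'w \<Rightarrow> 't) \<Rightarrow> nat \<Rightarrow> 't \<Rightarrow> real" where
  "learner_prob D R A k \<theta> =
     \<P>(y in (\<Pi>\<^sub>M i\<in>{..<k}. D) \<Otimes>\<^sub>M R. \<theta> = A (map (fst y) [0..<k]) (snd y))"

definition max_prob ::
  "'z measure \<Rightarrow> 'w measure \<Rightarrow> ('z list \<Rightarrow> 'w \<Rightarrow> 't) \<Rightarrow> 't set \<Rightarrow> nat \<Rightarrow> real" where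
  "max_prob D R A \<Theta> k = (MAX \<theta>\<in>\<Theta>. learner_prob D R A k \<theta>)"

definition max_prob_bad ::
  "'z measure \<Rightarrow> 'w measure \<Rightarrow> ('t \<Rightarrow> 'z \<Rightarrow> real) \<Rightarrow> ('z list \<Rightarrow> 'w \<Rightarrow> 't) \<Rightarrow> 't set \<Rightarrow> nat \<Rightarrow> real \<Rightarrow> real"
where
  "max_prob_bad D R l A \<Theta> k \<delta> =
     (if \<Theta> - near_optimal D l \<Theta> \<delta> = {} then 0
      else (MAX \<theta>\<in>\<Theta> - near_optimal D l \<Theta> \<delta>. learner_prob D R A k \<theta>))"

definition eta ::
  "'z measure \<Rightarrow> 'w measure \<Rightarrow> ('t \<Rightarrow> 'z \<Rightarrow> real) \<Rightarrow> ('z list \<Rightarrow> 'w \<Rightarrow> 't) \<Rightarrow> 't set \<Rightarrow> nat \<Rightarrow> real \<Rightarrow> real"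
where
  "eta D R l A \<Theta> k \<delta> = max_prob D R A \<Theta> k - max_prob_bad D R l A \<Theta> k \<delta>"

definition subsamples :: "nat \<Rightarrow> nat \<Rightarrow> nat list set" where
  "subsamples n k = {is. length is = k \<and> distinct is \<and> set is \<subseteq> {..<n}}"

text \<open>
  One run of the algorithm on an arbitrary probability space \<open>M\<close>. The data \<open>z\<close> have law \<open>D\<close>;
  round \<open>b\<close> applies the learner to the observations with (ordered) indices \<open>idx b\<close>, with
  algorithmic randomness \<open>w b\<close>. The assumption \<open>joint_law\<close> says that all of \<open>z i\<close> (\<open>i < n\<close>),
  \<open>idx b\<close> and \<open>w b\<close> (\<open>b < B\<close>) are mutually independent with laws \<open>D\<close>, uniform on
  \<open>subsamples n k\<close>, and \<open>R\<close>; it is stated as a product law because \<open>indep_vars\<close> requires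
  variables of one common type. Apart from measurability, \<open>out\<close> is constrained only to be a
  majority-vote winner, so ties may be broken by any rule, possibly with additional randomness
  from \<open>M\<close>.
\<close>

locale MoVE =
  prob_space M + data: prob_space D + noise: prob_space R
  for M :: "'s measure" and D :: "'z measure" and R :: "'w measure" +
  fixes \<Theta> :: "'t set"
    and l :: "'t \<Rightarrow> 'z \<Rightarrow> real"
    and A :: "'z list \<Rightarrow> 'w \<Rightarrow> 't"
    and n k B :: nat
    and z :: "nat \<Rightarrow> 's \<Rightarrow> 'z"
    and idx :: "nat \<Rightarrow> 's \<Rightarrow> nat list"
    and w :: "nat \<Rightarrow> 's \<Rightarrow> 'w"
    and out :: "'s \<Rightarrow> 't"
  assumes finite_space: "finite \<Theta>" and nonempty_space: "\<Theta> \<noteq> {}"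
    and cost_integrable: "\<And>\<theta>. \<theta> \<in> \<Theta> \<Longrightarrow> integrable D (l \<theta>)"
    and learner_measurable: "\<And>m. 0 < m \<Longrightarrow>
      (\<lambda>y. A (map (fst y) [0..<m]) (snd y)) \<in> (\<Pi>\<^sub>M i\<in>{..<m}. D) \<Otimes>\<^sub>M R \<rightarrow>\<^sub>M count_space \<Theta>"
    and subsample_size: "0 < k" "k \<le> n"
    and z_measurable: "\<And>i. i < n \<Longrightarrow> z i \<in> M \<rightarrow>\<^sub>M D"
    and idx_measurable: "\<And>b. b < B \<Longrightarrow> idx b \<in> M \<rightarrow>\<^sub>M uniform_count_measure (subsamples n k)"
    and w_measurable: "\<And>b. b < B \<Longrightarrow> w b \<in> M \<rightarrow>\<^sub>M R"
    and joint_law: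
      "distr M
         ((\<Pi>\<^sub>M i\<in>{..<n}. D) \<Otimes>\<^sub>M (\<Pi>\<^sub>M b\<in>{..<B}. uniform_count_measure (subsamples n k) \<Otimes>\<^sub>M R))
         (\<lambda>x. (\<lambda>i\<in>{..<n}. z i x, \<lambda>b\<in>{..<B}. (idx b x, w b x)))
       = (\<Pi>\<^sub>M i\<in>{..<n}. D) \<Otimes>\<^sub>M (\<Pi>\<^sub>M b\<in>{..<B}. uniform_count_measure (subsamples n k) \<Otimes>\<^sub>M R)"
    and out_measurable: "out \<in> M \<rightarrow>\<^sub>M count_space \<Theta>"
    and out_majority: "\<And>x. x \<in> space M \<Longrightarrow>
      is_arg_max
        (\<lambda>\<theta>. \<Sum>b<B. of_bool (\<theta> = A (map (\<lambda>i. z i x) (idx b x)) (w b x)) :: nat)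
        (\<lambda>\<theta>. \<theta> \<in> \<Theta>) (out x)"

text \<open>The Bernoulli divergence is extended-real valued, so the real-valued \<open>KL_divergence\<close> of the
  library does not apply.\<close>

definition kl_term :: "real \<Rightarrow> real \<Rightarrow> ereal" where
  "kl_term a b = (if a = 0 then 0 else if b = 0 then \<infinity> else ereal (a * ln (a / b)))"

definition KL_bernoulli :: "real \<Rightarrow> real \<Rightarrow> ereal" where
  "KL_bernoulli p q = kl_term p q + kl_term (1 - p) (1 - q)"

text \<open>The function \<open>x \<mapsto> exp (- x)\<close> with \<open>exp (- \<infinity>) = 0\<close>; it is only meant for \<open>x \<noteq> - \<infinity>\<close>.\<close>

definition exp_neg :: "ereal \<Rightarrow> real" where
  "exp_neg x = (if x = \<infinity> then 0 else exp (- real_of_ereal x))"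

text \<open>The two bounds as functions of \<open>N = |\<Theta>|\<close>, the sizes \<open>n\<close>, \<open>k\<close>, \<open>B\<close>, the largest selection
  probability \<open>p\<close>, the gap \<open>\<eta>\<close>, and the largest selection probability \<open>q = p - \<eta>\<close> outside the
  near-optimal set.\<close>

definition MoVE_bound :: "nat \<Rightarrow> nat \<Rightarrow> nat \<Rightarrow> nat \<Rightarrow> real \<Rightarrow> real \<Rightarrow> real" where
  "MoVE_bound N n k B p \<eta> = real N *
     (exp_neg (ereal (n / (2 * k)) * KL_bernoulli (p - 3 * \<eta> / 4) (p - \<eta>))
      + 2 * exp_neg (ereal (n / (2 * k)) * KL_bernoulli (p - \<eta> / 4) p)
      + exp (- (B / 24) * (\<eta>\<^sup>2 / (min p (1 - p) + 3 * \<eta> / 4)))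
      + of_bool (p + \<eta> / 4 \<le> 1) *
          exp_neg (ereal (n / (2 * k)) * KL_bernoulli (p + \<eta> / 4) p
                   + ereal (B / 24 * (\<eta>\<^sup>2 / (1 - p + \<eta> / 4)))))"

definition MoVE_simple_bound ::
  "real \<Rightarrow> real \<Rightarrow> real \<Rightarrow> nat \<Rightarrow> nat \<Rightarrow> nat \<Rightarrow> nat \<Rightarrow> real \<Rightarrow> real \<Rightarrow> real" where
  "MoVE_simple_bound C1 C2 C3 N n k B p q = real N *
     (3 * (min (exp (- 2 / 5)) (C1 * max (1 - p) q)) powr (n / (C2 * k)) + exp (- (B / C3)))"

end

theory Submission
  imports Defs "HOL-Combinatorics.Permutations" "HOL-Real_Asymp.Real_Asymp"
begin

text \<open>
  Fix a most likely decision \<open>\<theta>s\<close>, selected by the base learner with probability \<open>p\<close>, and write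
  \<open>\<eta>\<close> for the gap. A bad output \<open>\<theta>\<close>, which has selection probability at most \<open>p - \<eta>\<close>, can only
  win if it receives at least as many votes as \<open>\<theta>s\<close>. By a union bound over the bad decisions it
  suffices to bound the probability of this event for one \<open>\<theta>\<close> (\<open>prob_bad_outvotes_le\<close>).

  Condition on the data. Each round then votes for \<open>\<theta>\<close> with a probability that is a U-statistic of
  order \<open>k\<close> in the data (\<open>prob_vote\<close>) with mean the selection probability of \<open>\<theta>\<close>. Hoeffding's
  inequality for U-statistics (\<open>subsample_mean_tail_KL\<close>) bounds the probability that it reaches
  \<open>p - 3 \<eta> / 4\<close>, and likewise the probability that its analogue for \<open>\<theta>s\<close> falls to \<open>p - \<eta> / 4\<close>.
  These are the two divergence terms. For all other data the two vote probabilities are on the right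
  sides of \<open>c = p - 3 \<eta> / 4\<close> and \<open>a = p - \<eta> / 4\<close>, the \<open>B\<close> votes are independent, and Chernoff's
  method bounds the probability that \<open>\<theta>\<close> catches up with \<open>\<theta>s\<close> by
  \<open>exp (- B (sqrt a - sqrt c)\<^sup>2)\<close> (\<open>prob_votes_le\<close>). This exponent dominates the one that is claimed,
  because \<open>p + (p - \<eta>) \<le> 1\<close> (\<open>vote_rate_ge\<close>).

  The simplified bound is pure calculus: for a gap above \<open>4/5\<close> the divergences compare a number
  above \<open>1/5\<close> with a number that is at most \<open>max (1 - p) q\<close>, so they are bounded below by a constant
  and by a multiple of the logarithm of that maximum, up to an additive constant
  (\<open>exp_neg_KL_le_min_powr\<close>).
\<close>

section \<open>Averages over subsamples and over permutations\<close>

lemma finite_subsamples: "finite (subsamples n k)"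
proof (rule finite_subset)
  show "subsamples n k \<subseteq> {is. set is \<subseteq> {..<n} \<and> length is = k}"
    by (auto simp: subsamples_def)
qed (simp add: finite_lists_length_eq)

lemma upt_in_subsamples: "i + k \<le> n \<Longrightarrow> [i..<i + k] \<in> subsamples n k"
  by (auto simp: subsamples_def)

lemma map_permutes_subsamples:
  assumes "\<sigma> permutes {..<n}" and "is \<in> subsamples n k"
  shows "map \<sigma> is \<in> subsamples n k"
proof -
  have "\<sigma> ` set is \<subseteq> {..<n}"
    using assms permutes_in_image[OF assms(1)] by (auto simp: subsamples_def)
  then show ?thesis
    using assms permutes_inj_on[OF assms(1)] by (auto simp: subsamples_def distinct_map)
qed

lemma bij_betw_map_subsamples:
  assumes "\<sigma> permutes {..<n}"
  shows "bij_betw (map \<sigma>) (subsamples n k) (subsamples n k)"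
proof (rule bij_betw_byWitness[where f' = "map (inv \<sigma>)"])
  show "\<forall>is\<in>subsamples n k. map (inv \<sigma>) (map \<sigma> is) = is"
    using permutes_inverses[OF assms] by (simp add: comp_def)
  show "\<forall>is\<in>subsamples n k. map \<sigma> (map (inv \<sigma>) is) = is"
    using permutes_inverses[OF assms] by (simp add: comp_def)
qed (use assms permutes_inv[OF assms] map_permutes_subsamples in blast)+

lemma subsample_extends_to_permutation:
  assumes "is \<in> subsamples n k"
  obtains \<tau> where "\<tau> permutes {..<n}" and "map \<tau> [0..<k] = is"
proof -
  have len: "length is = k" and dist: "distinct is" and sub: "set is \<subseteq> {..<n}"
    using assms by (auto simp: subsamples_def)
  obtain js where js: "set js = {..<n} - set is" "distinct js"
    using finite_distinct_list[of "{..<n} - set is"] by auto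
  define xs where "xs = is @ js"
  have xs: "distinct xs" "set xs = {..<n}"
    using js dist sub by (auto simp: xs_def)
  then have lxs: "length xs = n"
    using distinct_card[OF xs(1)] by simp
  define \<tau> where "\<tau> = (\<lambda>i. if i < n then xs ! i else i)"
  have "bij_betw ((!) xs) {..<n} {..<n}"
    using bij_betw_nth[OF xs(1)] xs(2) lxs by auto
  then have "bij_betw \<tau> {..<n} {..<n}"
    by (rule bij_betw_cong[THEN iffD1, rotated]) (simp add: \<tau>_def)
  then have "\<tau> permutes {..<n}"
    by (rule bij_imp_permutes) (simp add: \<tau>_def)
  moreover have "k \<le> n"
    using lxs len by (simp add: xs_def)
  then have "map \<tau> [0..<k] = is"
    using len by (intro nth_equalityI) (auto simp: \<tau>_def xs_def nth_append)
  ultimately show thesis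
    by (rule that)
qed

text \<open>The sum over permutations does not depend on the subsample, because any two subsamples differ by a
permutation of the indices; averaging it over all subsamples then identifies its value, since every
permutation also permutes the set of subsamples. This avoids counting the permutations that realise
a given subsample.\<close>

lemma sum_permutes_subsample:
  fixes f :: "nat list \<Rightarrow> real"
  assumes xs: "xs \<in> subsamples n k"
  shows "(\<Sum>\<sigma> | \<sigma> permutes {..<n}. f (map \<sigma> xs)) / fact n
    = (\<Sum>is\<in>subsamples n k. f is) / card (subsamples n k)"
proof -
  define P where "P = {\<sigma>. \<sigma> permutes {..<n}}"
  define F where "F = (\<lambda>is. \<Sum>\<sigma>\<in>P. f (map \<sigma> is))"
  have "F is = F [0..<k]" if is_in: "is \<in> subsamples n k" for "is"
  proof -
    obtain \<tau> where \<tau>: "\<tau> permutes {..<n}" "map \<tau> [0..<k] = is"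
      using subsample_extends_to_permutation[OF is_in] .
    have "F [0..<k] = (\<Sum>\<sigma>\<in>P. f (map (\<sigma> \<circ> \<tau>) [0..<k]))"
      unfolding F_def P_def by (rule sum_permutations_compose_right[OF \<tau>(1)])
    also have "\<dots> = F is"
      using \<tau>(2) by (simp add: F_def flip: map_map)
    finally show ?thesis ..
  qed
  then have const: "F is = F xs" if "is \<in> subsamples n k" for "is"
    using that xs by metis
  have "card (subsamples n k) * F xs = (\<Sum>is\<in>subsamples n k. F is)"
    by (simp add: const)
  also have "\<dots> = (\<Sum>\<sigma>\<in>P. \<Sum>is\<in>subsamples n k. f (map \<sigma> is))"
    unfolding F_def by (rule sum.swap)
  also have "\<dots> = (\<Sum>\<sigma>\<in>P. \<Sum>is\<in>subsamples n k. f is)"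
    by (intro sum.cong refl sum.reindex_bij_betw[OF bij_betw_map_subsamples]) (simp add: P_def)
  also have "\<dots> = fact n * (\<Sum>is\<in>subsamples n k. f is)"
    using card_permutations[of "{..<n}" n] by (simp add: P_def)
  finally have "card (subsamples n k) * F xs = fact n * (\<Sum>is\<in>subsamples n k. f is)" .
  moreover have "card (subsamples n k) > 0"
    using xs finite_subsamples by (auto simp: card_gt_0_iff)
  ultimately show ?thesis
    by (simp add: F_def P_def field_simps)
qed

section \<open>Lower bounds on the Bernoulli divergence\<close>

lemma exp_neg_nonneg: "0 \<le> exp_neg x"
  by (simp add: exp_neg_def)

lemma exp_neg_ereal [simp]: "exp_neg (ereal x) = exp (- x)"
  by (simp add: exp_neg_def)

lemma exp_neg_infty [simp]: "exp_neg \<infinity> = 0"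
  by (simp add: exp_neg_def)

lemma KL_bernoulli_complement: "KL_bernoulli (1 - p) (1 - q) = KL_bernoulli p q"
  by (simp add: KL_bernoulli_def add.commute)

lemma KL_bernoulli_real:
  assumes "0 < p" "p < 1" "0 < q" "q < 1"
  shows "KL_bernoulli p q = ereal (p * ln (p / q) + (1 - p) * ln ((1 - p) / (1 - q)))"
  using assms by (simp add: KL_bernoulli_def kl_term_def)

lemma KL_bernoulli_0:
  assumes "0 < p" "p < 1"
  shows "KL_bernoulli p 0 = \<infinity>"
  using assms by (simp add: KL_bernoulli_def kl_term_def)

text \<open>Obtained from \<open>ln u \<le> 2 (sqrt u - 1)\<close>. Summed over the two outcomes of a Bernoulli variable,
the left-hand sides give twice the squared Hellinger distance.\<close>

lemma x_ln_ratio_ge: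
  fixes x y :: real
  assumes "0 < x" "0 < y"
  shows "2 * x - 2 * sqrt (x * y) \<le> x * ln (x / y)"
proof -
  have "ln (sqrt (y / x)) \<le> sqrt (y / x) - 1"
    using assms by (intro ln_le_minus_one) simp
  then have "ln (y / x) \<le> 2 * (sqrt (y / x) - 1)"
    using assms by (simp add: ln_sqrt)
  then have "2 - 2 * sqrt (y / x) \<le> ln (x / y)"
    using assms by (simp add: ln_div)
  then have "x * (2 - 2 * sqrt (y / x)) \<le> x * ln (x / y)"
    using assms by (intro mult_left_mono) auto
  moreover have "x * sqrt (y / x) = sqrt (x * y)"
    using assms by (simp add: real_sqrt_mult real_sqrt_divide field_simps)
  ultimately show ?thesis
    by (simp add: algebra_simps)
qed

text \<open>From \<open>x - y = (sqrt x - sqrt y) (sqrt x + sqrt y)\<close>; it serves both the quadratic lower bound on the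
divergence and the rate of the vote comparison, where a squared difference of square roots is the
natural exponent.\<close>

lemma sqrt_diff_square_ge:
  fixes x y :: real
  assumes "0 \<le> x" "0 \<le> y" "0 < x + y"
  shows "(x - y)\<^sup>2 / (2 * (x + y)) \<le> (sqrt x - sqrt y)\<^sup>2"
proof -
  have "(sqrt x + sqrt y)\<^sup>2 \<le> 2 * (x + y)"
    using assms sum_squares_ge_zero[of "sqrt x - sqrt y" 0]
    by (simp add: power2_eq_square algebra_simps)
  then have "(sqrt x - sqrt y)\<^sup>2 * (sqrt x + sqrt y)\<^sup>2 \<le> (sqrt x - sqrt y)\<^sup>2 * (2 * (x + y))"
    by (intro mult_left_mono) auto
  moreover have "(sqrt x - sqrt y) * (sqrt x + sqrt y) = x - y"
    using assms by (simp add: algebra_simps)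
  then have "(sqrt x - sqrt y)\<^sup>2 * (sqrt x + sqrt y)\<^sup>2 = (x - y)\<^sup>2"
    by (metis power_mult_distrib)
  ultimately show ?thesis
    using assms by (simp add: divide_le_eq)
qed

text \<open>A form of Pinsker's inequality, with the constant that the Hellinger distance gives directly.\<close>

lemma KL_bernoulli_quadratic:
  fixes p q :: real
  assumes "0 < p" "p < 1" "0 < q" "q < 1"
  shows "(p - q)\<^sup>2 / 4 \<le> p * ln (p / q) + (1 - p) * ln ((1 - p) / (1 - q))"
proof -
  have "(p - q)\<^sup>2 / 4 \<le> (p - q)\<^sup>2 / (2 * (p + q))"
    using assms by (intro divide_left_mono) auto
  also have "\<dots> \<le> (sqrt p - sqrt q)\<^sup>2"
    using assms by (intro sqrt_diff_square_ge) auto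
  also have "\<dots> \<le> (sqrt p - sqrt q)\<^sup>2 + (sqrt (1 - p) - sqrt (1 - q))\<^sup>2"
    by simp
  also have "\<dots> = (2 * p - 2 * sqrt (p * q)) + (2 * (1 - p) - 2 * sqrt ((1 - p) * (1 - q)))"
    unfolding real_sqrt_mult using assms by (simp add: power2_eq_square algebra_simps)
  also have "\<dots> \<le> p * ln (p / q) + (1 - p) * ln ((1 - p) / (1 - q))"
    using assms by (intro add_mono x_ln_ratio_ge) auto
  finally show ?thesis .
qed

text \<open>The divergence is the cross entropy minus the entropy of \<open>p\<close>, and the entropy is at most 1. This
is the estimate that is effective for small \<open>q\<close>, where the quadratic one saturates.\<close>

lemma KL_bernoulli_log:
  fixes p q :: real
  assumes "0 < p" "p < 1" "0 < q" "q < 1"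
  shows "p * - ln q - 1 \<le> p * ln (p / q) + (1 - p) * ln ((1 - p) / (1 - q))"
proof -
  have *: "x - 1 \<le> x * ln x" if "0 < x" for x :: real
  proof -
    have "x * ln (1 / x) \<le> x * (1 / x - 1)"
      using that by (intro mult_left_mono ln_le_minus_one) auto
    then show ?thesis
      using that by (simp add: ln_div algebra_simps)
  qed
  have "0 \<le> (1 - p) * - ln (1 - q)"
    using assms by (intro mult_nonneg_nonneg) auto
  moreover have "p * ln (p / q) + (1 - p) * ln ((1 - p) / (1 - q))
      = p * ln p + (1 - p) * ln (1 - p) + p * - ln q + (1 - p) * - ln (1 - q)"
    using assms by (simp add: ln_div algebra_simps)
  ultimately show ?thesis
    using *[of p] *[of "1 - p"] assms by linarith
qed

section \<open>The bound for a large gap\<close>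

text \<open>The two arguments of the minimum come from the two lower bounds on the divergence: the quadratic
bound gives \<open>1/100\<close>, hence \<open>40/100 = 2/5\<close> after multiplication by 40, and the logarithmic bound
gives \<open>- ln (exp 5 * q) / 5\<close>. The exponent \<open>c / 80\<close> is \<open>c / 2\<close> divided by this factor 40.\<close>

lemma exp_neg_KL_le_min_powr:
  assumes q: "0 \<le> q" "q \<le> r" and p: "q + 1 / 5 \<le> p" "p < 1" and c: "0 < (c :: real)"
  shows "exp_neg (ereal (c / 2) * KL_bernoulli p q)
    \<le> min (exp (- 2 / 5)) (exp 5 * r) powr (c / 80)"
proof (cases "q = 0")
  case True
  then show ?thesis
    using p c by (simp add: KL_bernoulli_0)
next
  case False
  then have q': "0 < q"
    using q by simp
  define K where "K = p * ln (p / q) + (1 - p) * ln ((1 - p) / (1 - q))"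
  define m where "m = min (exp (- 2 / 5)) (exp 5 * r)"
  have "0 < m"
    using q q' by (simp add: m_def)
  have "(1 / 5)\<^sup>2 \<le> (p - q)\<^sup>2"
    using p by (intro power_mono) auto
  then have K1: "1 / 100 \<le> K"
    using KL_bernoulli_quadratic[of p q] p q' by (simp add: K_def power2_eq_square)
  have K2: "- ln (exp 5 * q) \<le> 5 * K"
  proof -
    have "1 / 5 * - ln q \<le> p * - ln q"
      using p q' by (intro mult_right_mono) auto
    moreover have "p * - ln q - 1 \<le> K"
      using KL_bernoulli_log[of p q] p q' by (simp add: K_def)
    moreover have "- ln (exp 5 * q) = - 5 - ln q"
      using q' by (simp add: ln_mult)
    ultimately show ?thesis
      by linarith
  qed
  have "- ln m \<le> 40 * K"
  proof (cases "m = exp (- 2 / 5)")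
    case True
    then show ?thesis
      using K1 by simp
  next
    case False
    then have "m = exp 5 * r"
      by (auto simp: m_def min_def split: if_splits)
    then have "- ln m \<le> - ln (exp 5 * q)"
      using q q' by (simp add: ln_mult)
    then show ?thesis
      using K1 K2 by linarith
  qed
  then have "exp (- (c / 2 * K)) \<le> exp (c / 80 * ln m)"
    using c mult_left_mono[of "- ln m" "40 * K" "c / 80"] by simp
  also have "\<dots> = m powr (c / 80)"
    using \<open>0 < m\<close> by (simp add: powr_def)
  finally show ?thesis
    using p q' by (simp add: KL_bernoulli_real K_def m_def)
qed

text \<open>Since \<open>p + q \<le> 1\<close> and \<open>\<eta> > 4/5\<close>, the thresholds in both divergences lie at least
\<open>\<eta> / 4 > 1/5\<close> away from a mean that is at most \<open>max (1 - p) q\<close> (in the second divergence after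
exchanging success and failure).\<close>

lemma MoVE_bound_le_simple_bound:
  assumes k: "0 < k" "k \<le> n" and q: "0 \<le> q" "p + q \<le> 1" and \<eta>: "p = q + \<eta>" "4 / 5 < \<eta>"
  shows "MoVE_bound N n k B p \<eta> \<le> MoVE_simple_bound (exp 5) 80 30 N n k B p q"
proof -
  define m where "m = min (exp (- 2 / 5)) (exp 5 * max (1 - p) q) powr (real n / (80 * real k))"
  have c: "0 < real n / real k"
    using k by simp
  have T: "exp_neg (ereal (n / (2 * k)) * KL_bernoulli x y) \<le> m"
    if "0 \<le> y" "y \<le> max (1 - p) q" "y + 1 / 5 \<le> x" "x < 1" for x y
    using exp_neg_KL_le_min_powr[OF that c] by (simp add: m_def mult.commute)
  have T1: "exp_neg (ereal (n / (2 * k)) * KL_bernoulli (p - 3 * \<eta> / 4) (p - \<eta>)) \<le> m"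
    using q \<eta> by (intro T) auto
  have "exp_neg (ereal (n / (2 * k)) * KL_bernoulli (1 - (p - \<eta> / 4)) (1 - p)) \<le> m"
    using q \<eta> by (intro T) auto
  then have T2: "exp_neg (ereal (n / (2 * k)) * KL_bernoulli (p - \<eta> / 4) p) \<le> m"
    by (simp only: KL_bernoulli_complement)
  have sq: "(4 / 5)\<^sup>2 \<le> \<eta>\<^sup>2"
    using \<eta> by (intro power_mono) auto
  have pos: "0 < min p (1 - p) + 3 * \<eta> / 4"
    using \<eta> q by auto
  have "(4 / 5) * (min p (1 - p) + 3 * \<eta> / 4) \<le> (4 / 5)\<^sup>2"
    using \<eta> q by (simp add: power2_eq_square)
  also note sq
  finally have "4 / 5 \<le> \<eta>\<^sup>2 / (min p (1 - p) + 3 * \<eta> / 4)"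
    using pos by (simp only: le_divide_eq if_True)
  then have "real B / 24 * (4 / 5) \<le> real B / 24 * (\<eta>\<^sup>2 / (min p (1 - p) + 3 * \<eta> / 4))"
    by (intro mult_left_mono) auto
  then have T3: "exp (- (real B / 24) * (\<eta>\<^sup>2 / (min p (1 - p) + 3 * \<eta> / 4)))
      \<le> exp (- (real B / 30))"
    by simp
  \<comment> \<open>The last summand of the bound vanishes: \<open>p \<ge> \<eta> > 4/5\<close>.\<close>
  have T4: "\<not> p + \<eta> / 4 \<le> 1"
    using \<eta> q by linarith
  have "x1 + 2 * x2 + x3 + of_bool P * x4 \<le> 3 * m + x5"
    if "x1 \<le> m" "x2 \<le> m" "x3 \<le> x5" "\<not> P" for x1 x2 x3 x4 x5 and P
    using that by simp
  from this[OF T1 T2 T3 T4] show ?thesis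
    unfolding MoVE_bound_def MoVE_simple_bound_def m_def by (intro mult_left_mono) auto
qed

section \<open>A Chernoff bound for U-statistics\<close>

text \<open>By convexity, the exponential lies below its chord on the unit interval, which reduces a general
\<open>[0,1]\<close>-valued variable to a Bernoulli variable.\<close>

lemma (in prob_space) expectation_exp_le:
  fixes X :: "'a \<Rightarrow> real"
  assumes [measurable]: "X \<in> borel_measurable M"
    and X: "\<And>x. x \<in> space M \<Longrightarrow> 0 \<le> X x" "\<And>x. x \<in> space M \<Longrightarrow> X x \<le> 1"
    and mean: "expectation X \<le> \<mu>" and s: "0 \<le> s"
  shows "expectation (\<lambda>x. exp (s * X x)) \<le> 1 - \<mu> + \<mu> * exp s"
proof -
  have "norm (X x) \<le> 1" if "x \<in> space M" for x
    using X[OF that] by simp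
  then have int: "integrable M X"
    by (intro integrable_const_bound[where B = 1] AE_I2) auto
  have "exp (s * X x) \<le> 1 + X x * (exp s - 1)" if "x \<in> space M" for x
    using convex_onD[OF exp_convex, of "X x" 0 s] X[OF that] by (simp add: algebra_simps)
  then have "expectation (\<lambda>x. exp (s * X x)) \<le> expectation (\<lambda>x. 1 + X x * (exp s - 1))"
  proof (intro integral_mono)
    show "integrable M (\<lambda>x. exp (s * X x))"
      using X s by (intro integrable_const_bound[where B = "exp s"] AE_I2) (auto simp: mult_left_le)
    show "integrable M (\<lambda>x. 1 + X x * (exp s - 1))"
      using int by simp
  qed
  also have "\<dots> = 1 + expectation X * (exp s - 1)"
    using int by (simp add: prob_space)
  also have "\<dots> \<le> 1 + \<mu> * (exp s - 1)"
    using mean s by (intro add_mono mult_right_mono) auto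
  finally show ?thesis
    by (simp add: algebra_simps)
qed

text \<open>The U-statistic of order \<open>k\<close> with the (possibly asymmetric) kernel \<open>g\<close>.\<close>

definition subsample_mean :: "nat \<Rightarrow> nat \<Rightarrow> ((nat \<Rightarrow> 'z) \<Rightarrow> real) \<Rightarrow> (nat \<Rightarrow> 'z) \<Rightarrow> real" where
  "subsample_mean n k g y =
     (\<Sum>is\<in>subsamples n k. g (\<lambda>i\<in>{..<k}. y (is ! i))) / card (subsamples n k)"

context prob_space
begin

lemma prob_space_PiM_const: "prob_space (\<Pi>\<^sub>M i\<in>I. M)"
  by (rule prob_space_PiM) (rule prob_space_axioms)

lemma distr_PiM_subfamily:
  assumes "inj_on f {..<k}" "f ` {..<k} \<subseteq> {..<n}"
  shows "distr (\<Pi>\<^sub>M i\<in>{..<n}. M) (\<Pi>\<^sub>M i\<in>{..<k}. M) (\<lambda>y. \<lambda>i\<in>{..<k}. y (f i)) = (\<Pi>\<^sub>M i\<in>{..<k}. M)"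
  using distr_PiM_reindex[of "{..<n}" "\<lambda>_. M" f "{..<k}"] assms prob_space_axioms by auto

lemma measurable_subfamily:
  assumes "f ` {..<k} \<subseteq> {..<n}"
  shows "(\<lambda>y. \<lambda>i\<in>{..<k}. y (f i)) \<in> (\<Pi>\<^sub>M i\<in>{..<n}. M) \<rightarrow>\<^sub>M (\<Pi>\<^sub>M i\<in>{..<k}. M)"
  using assms by (intro measurable_restrict measurable_component_singleton) auto

text \<open>Disjoint blocks of coordinates are independent, and each block has the law of \<open>k\<close> fresh
observations.\<close>

lemma integral_prod_blocks:
  fixes f :: "nat \<Rightarrow> nat \<Rightarrow> nat" and g :: "(nat \<Rightarrow> 'a) \<Rightarrow> real"
  assumes inj: "\<And>j. j < m \<Longrightarrow> inj_on (f j) {..<k}"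
    and disj: "disjoint_family_on (\<lambda>j. f j ` {..<k}) {..<m}"
    and sub: "\<And>j. j < m \<Longrightarrow> f j ` {..<k} \<subseteq> {..<n}"
    and n: "0 < n"
    and g: "g \<in> borel_measurable (\<Pi>\<^sub>M i\<in>{..<k}. M)"
    and bdd: "\<And>v. v \<in> space (\<Pi>\<^sub>M i\<in>{..<k}. M) \<Longrightarrow> \<bar>g v\<bar> \<le> C"
  shows "(\<integral>y. (\<Prod>j<m. g (\<lambda>i\<in>{..<k}. y (f j i))) \<partial>(\<Pi>\<^sub>M i\<in>{..<n}. M))
    = (\<integral>v. g v \<partial>(\<Pi>\<^sub>M i\<in>{..<k}. M)) ^ m"
proof -
  interpret P: prob_space "\<Pi>\<^sub>M i\<in>{..<n}. M"
    by (rule prob_space_PiM_const)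
  have coord: "P.indep_vars (\<lambda>_. M) (\<lambda>i y. y i) {..<n}"
  proof -
    have "distr (\<Pi>\<^sub>M i\<in>{..<n}. M) M (\<lambda>y. y i) = M" if "i < n" for i
      using distr_PiM_component[of "{..<n}" "\<lambda>_. M" i] prob_space_axioms that by simp
    then have "(\<Pi>\<^sub>M i\<in>{..<n}. distr (\<Pi>\<^sub>M i\<in>{..<n}. M) M (\<lambda>y. y i)) = (\<Pi>\<^sub>M i\<in>{..<n}. M)"
      by (intro PiM_cong) auto
    moreover have "distr (\<Pi>\<^sub>M i\<in>{..<n}. M) (\<Pi>\<^sub>M i\<in>{..<n}. M) (\<lambda>y. \<lambda>i\<in>{..<n}. y i)
        = (\<Pi>\<^sub>M i\<in>{..<n}. M)"
      using distr_PiM_subfamily[of "\<lambda>i. i" n n] by simp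
    ultimately show ?thesis
      using n by (subst P.indep_vars_iff_distr_eq_PiM') auto
  qed
  define G where "G = (\<lambda>j u. g (\<lambda>i\<in>{..<k}. u (f j i)))"
  have G_meas: "G j \<in> borel_measurable (\<Pi>\<^sub>M i\<in>f j ` {..<k}. M)" for j
    unfolding G_def
    by (rule measurable_compose[OF measurable_restrict g]) (auto intro!: measurable_component_singleton)
  have "P.indep_vars (\<lambda>_. borel) (\<lambda>j y. G j (\<lambda>i\<in>f j ` {..<k}. y i)) {..<m}"
    using P.indep_vars_compose2[OF P.indep_vars_restrict[OF coord _ disj], of G "\<lambda>_. borel"]
      sub G_meas by auto
  moreover have "G j (\<lambda>i\<in>f j ` {..<k}. y i) = g (\<lambda>i\<in>{..<k}. y (f j i))" for j y
    unfolding G_def by (rule arg_cong[of _ _ g]) (auto simp: restrict_def)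
  ultimately have indep: "P.indep_vars (\<lambda>_. borel) (\<lambda>j y. g (\<lambda>i\<in>{..<k}. y (f j i))) {..<m}"
    by simp
  have meas: "(\<lambda>y. g (\<lambda>i\<in>{..<k}. y (f j i))) \<in> borel_measurable (\<Pi>\<^sub>M i\<in>{..<n}. M)" if "j < m" for j
    using measurable_compose[OF measurable_subfamily[OF sub[OF that]] g] .
  have int: "integrable (\<Pi>\<^sub>M i\<in>{..<n}. M) (\<lambda>y. g (\<lambda>i\<in>{..<k}. y (f j i)))" if "j < m" for j
    using meas[OF that] bdd measurable_space[OF measurable_subfamily[OF sub[OF that]]]
    by (intro P.integrable_const_bound[where B = C] AE_I2) auto
  have "(\<integral>y. (\<Prod>j<m. g (\<lambda>i\<in>{..<k}. y (f j i))) \<partial>(\<Pi>\<^sub>M i\<in>{..<n}. M))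
      = (\<Prod>j<m. \<integral>y. g (\<lambda>i\<in>{..<k}. y (f j i)) \<partial>(\<Pi>\<^sub>M i\<in>{..<n}. M))"
    using int by (intro P.indep_vars_lebesgue_integral indep) auto
  also have "\<dots> = (\<Prod>j<m. \<integral>v. g v \<partial>(\<Pi>\<^sub>M i\<in>{..<k}. M))"
  proof (rule prod.cong[OF refl])
    fix j assume "j \<in> {..<m}"
    then have j: "j < m" by simp
    have "(\<integral>v. g v \<partial>(\<Pi>\<^sub>M i\<in>{..<k}. M))
        = (\<integral>v. g v \<partial>distr (\<Pi>\<^sub>M i\<in>{..<n}. M) (\<Pi>\<^sub>M i\<in>{..<k}. M) (\<lambda>y. \<lambda>i\<in>{..<k}. y (f j i)))"
      by (simp add: distr_PiM_subfamily[OF inj[OF j] sub[OF j]])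
    also have "\<dots> = (\<integral>y. g (\<lambda>i\<in>{..<k}. y (f j i)) \<partial>(\<Pi>\<^sub>M i\<in>{..<n}. M))"
      by (rule integral_distr[OF measurable_subfamily[OF sub[OF j]] g])
    finally show "(\<integral>y. g (\<lambda>i\<in>{..<k}. y (f j i)) \<partial>(\<Pi>\<^sub>M i\<in>{..<n}. M)) = (\<integral>v. g v \<partial>(\<Pi>\<^sub>M i\<in>{..<k}. M))" ..
  qed
  finally show ?thesis
    by simp
qed


lemma measurable_subsample_mean:
  assumes g: "g \<in> borel_measurable (\<Pi>\<^sub>M i\<in>{..<k}. M)"
  shows "subsample_mean n k g \<in> borel_measurable (\<Pi>\<^sub>M i\<in>{..<n}. M)"
  unfolding subsample_mean_def
proof (intro borel_measurable_divide borel_measurable_sum borel_measurable_const)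
  fix "is" assume "is \<in> subsamples n k"
  then have "(!) is ` {..<k} \<subseteq> {..<n}"
    using nth_mem[of _ "is"] unfolding subsamples_def by blast
  then show "(\<lambda>y. g (\<lambda>i\<in>{..<k}. y (is ! i))) \<in> borel_measurable (\<Pi>\<^sub>M i\<in>{..<n}. M)"
    by (intro measurable_compose[OF measurable_subfamily g])
qed

text \<open>Hoeffding's representation: a U-statistic is a mean, over the orderings of the data, of averages
over the \<open>n div k\<close> consecutive disjoint blocks, and each of these averages has independent terms.\<close>

lemma subsample_mean_eq_mean_of_blocks:
  assumes k: "0 < k" "k \<le> n"
  shows "subsample_mean n k g y =
    (\<Sum>\<sigma> | \<sigma> permutes {..<n}. 1 / fact n *
      ((\<Sum>j<n div k. g (\<lambda>i\<in>{..<k}. y (\<sigma> (j * k + i)))) / (n div k)))"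
proof -
  define m where "m = n div k"
  have m: "0 < m"
    using k by (simp add: m_def div_greater_zero_iff)
  have block: "subsample_mean n k g y =
      (\<Sum>\<sigma> | \<sigma> permutes {..<n}. g (\<lambda>i\<in>{..<k}. y (\<sigma> (j * k + i)))) / fact n" if "j < m" for j
  proof -
    have "Suc j * k \<le> m * k"
      using that by (intro mult_right_mono) auto
    also have "\<dots> \<le> n"
      by (simp add: m_def)
    finally have "[j * k..<j * k + k] \<in> subsamples n k"
      by (intro upt_in_subsamples) simp
    from sum_permutes_subsample[OF this, of "\<lambda>is. g (\<lambda>i\<in>{..<k}. y (is ! i))"]
    show ?thesis
      by (simp add: subsample_mean_def cong: restrict_cong)
  qed
  have "subsample_mean n k g y = (\<Sum>j<m. subsample_mean n k g y) / m"
    using m by simp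
  also have "\<dots> = (\<Sum>j<m. (\<Sum>\<sigma> | \<sigma> permutes {..<n}.
      g (\<lambda>i\<in>{..<k}. y (\<sigma> (j * k + i)))) / fact n) / m"
    using block by simp
  also have "\<dots> = (\<Sum>\<sigma> | \<sigma> permutes {..<n}. \<Sum>j<m. g (\<lambda>i\<in>{..<k}. y (\<sigma> (j * k + i)))) / fact n / m"
    by (subst sum.swap) (simp add: sum_divide_distrib)
  finally show ?thesis
    by (simp add: sum_divide_distrib m_def mult.commute)
qed

text \<open>The terms of Hoeffding's representation for different orderings are dependent, but by convexity of
the exponential its moment generating function is at most the mean of those of the block averages.\<close>

lemma subsample_mean_tail_exp:
  assumes k: "0 < k" "k \<le> n"
    and g: "g \<in> borel_measurable (\<Pi>\<^sub>M i\<in>{..<k}. M)"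
    and g01: "\<And>v. v \<in> space (\<Pi>\<^sub>M i\<in>{..<k}. M) \<Longrightarrow> 0 \<le> g v"
      "\<And>v. v \<in> space (\<Pi>\<^sub>M i\<in>{..<k}. M) \<Longrightarrow> g v \<le> 1"
    and mean: "(\<integral>v. g v \<partial>(\<Pi>\<^sub>M i\<in>{..<k}. M)) \<le> \<mu>"
    and s: "0 \<le> s"
  shows "\<P>(y in \<Pi>\<^sub>M i\<in>{..<n}. M. x \<le> subsample_mean n k g y)
    \<le> (exp (- (s * x)) * (1 - \<mu> + \<mu> * exp s)) ^ (n div k)"
proof -
  define m where "m = n div k"
  have m: "0 < m"
    using k by (simp add: m_def div_greater_zero_iff)
  define Q where "Q = {\<sigma>. \<sigma> permutes {..<n}}"
  have Q: "finite Q" "card Q = fact n" "id \<in> Q"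
    using card_permutations[of "{..<n}" n] finite_permutations[of "{..<n}"] permutes_id[of "{..<n}"]
    unfolding Q_def by auto
  let ?P = "\<Pi>\<^sub>M i\<in>{..<n}. M"
  interpret P: prob_space ?P
    by (rule prob_space_PiM_const)
  interpret K: prob_space "\<Pi>\<^sub>M i\<in>{..<k}. M"
    by (rule prob_space_PiM_const)
  define f where "f = (\<lambda>(\<sigma> :: nat \<Rightarrow> nat) j i. \<sigma> (j * k + i))"
  define h where "h = (\<lambda>v. exp (s * g v))"
  have h: "h \<in> borel_measurable (\<Pi>\<^sub>M i\<in>{..<k}. M)"
    unfolding h_def using g by measurable
  have h_bdd: "\<bar>h v\<bar> \<le> exp s" if "v \<in> space (\<Pi>\<^sub>M i\<in>{..<k}. M)" for v
    using g01(2)[OF that] s by (simp add: h_def mult_left_le)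
  have sub: "f \<sigma> j ` {..<k} \<subseteq> {..<n}" if "\<sigma> \<in> Q" "j < m" for \<sigma> j
  proof -
    have "Suc j * k \<le> m * k"
      using that by (intro mult_right_mono) auto
    also have "\<dots> \<le> n"
      by (simp add: m_def)
    finally have "j * k + i < n" if "i < k" for i
      using that by simp
    then show ?thesis
      using permutes_in_image[of \<sigma> "{..<n}"] that by (auto simp: Q_def f_def)
  qed
  have inj: "inj_on (f \<sigma> j) {..<k}" if "\<sigma> \<in> Q" for \<sigma> j
    using permutes_inj[of \<sigma> "{..<n}"] that by (intro inj_onI) (simp add: Q_def f_def inj_eq)
  have disj: "disjoint_family_on (\<lambda>j. f \<sigma> j ` {..<k}) {..<m}" if "\<sigma> \<in> Q" for \<sigma>
  proof -
    have "j = j'" if "f \<sigma> j i = f \<sigma> j' i'" "i < k" "i' < k" for i i' j j'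
    proof -
      have "j * k + i = j' * k + i'"
        using that \<open>\<sigma> \<in> Q\<close> permutes_inj[of \<sigma> "{..<n}"] by (simp add: Q_def f_def inj_eq)
      then have "(j * k + i) div k = (j' * k + i') div k"
        by simp
      then show ?thesis
        using that by simp
    qed
    then show ?thesis
      by (fastforce simp: disjoint_family_on_def)
  qed
  define W where "W = (\<lambda>\<sigma> y. \<Prod>j<m. h (\<lambda>i\<in>{..<k}. y (f \<sigma> j i)))"
  have blk: "(\<lambda>y. \<lambda>i\<in>{..<k}. y (f \<sigma> j i)) \<in> ?P \<rightarrow>\<^sub>M (\<Pi>\<^sub>M i\<in>{..<k}. M)" if "\<sigma> \<in> Q" "j < m" for \<sigma> j
    using measurable_subfamily[OF sub[OF that]] .
  have W_meas: "W \<sigma> \<in> borel_measurable ?P" if "\<sigma> \<in> Q" for \<sigma>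
    unfolding W_def using measurable_compose[OF blk[OF that] h] by (intro borel_measurable_prod) auto
  have W_int: "integrable ?P (W \<sigma>)" if "\<sigma> \<in> Q" for \<sigma>
  proof (rule P.integrable_const_bound[where B = "exp s ^ m"])
    show "AE y in ?P. norm (W \<sigma> y) \<le> exp s ^ m"
    proof (rule AE_I2)
      fix y assume y: "y \<in> space ?P"
      have "norm (W \<sigma> y) \<le> (\<Prod>j<m. exp s)"
        unfolding W_def prod_norm[symmetric]
        using h_bdd[OF measurable_space[OF blk[OF that] y]] by (intro prod_mono) auto
      then show "norm (W \<sigma> y) \<le> exp s ^ m"
        by simp
    qed
  qed (rule W_meas[OF that])
  have W_mean: "(\<integral>y. W \<sigma> y \<partial>?P) \<le> (1 - \<mu> + \<mu> * exp s) ^ m" if "\<sigma> \<in> Q" for \<sigma>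
  proof -
    have "(\<integral>y. W \<sigma> y \<partial>?P) = (\<integral>v. h v \<partial>(\<Pi>\<^sub>M i\<in>{..<k}. M)) ^ m"
      unfolding W_def using k h h_bdd inj[OF that] disj[OF that] sub[OF that]
      by (intro integral_prod_blocks) auto
    also have "\<dots> \<le> (1 - \<mu> + \<mu> * exp s) ^ m"
      using K.expectation_exp_le[OF g g01 mean s]
      by (intro power_mono integral_nonneg_AE) (auto simp: h_def)
    finally show ?thesis .
  qed
  define V where "V = (\<lambda>y. \<Sum>\<sigma>\<in>Q. 1 / fact n * W \<sigma> y)"
  have V_int: "integrable ?P V"
    unfolding V_def using W_int by (intro Bochner_Integration.integrable_sum integrable_mult_right) auto
  have "(\<integral>y. V y \<partial>?P) = (\<Sum>\<sigma>\<in>Q. 1 / fact n * (\<integral>y. W \<sigma> y \<partial>?P))"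
    unfolding V_def using W_int by (subst Bochner_Integration.integral_sum) auto
  also have "\<dots> \<le> (\<Sum>\<sigma>\<in>Q. 1 / fact n * (1 - \<mu> + \<mu> * exp s) ^ m)"
    using W_mean by (intro sum_mono mult_left_mono) auto
  also have "\<dots> = (1 - \<mu> + \<mu> * exp s) ^ m"
    using Q by simp
  finally have V_mean: "(\<integral>y. V y \<partial>?P) \<le> (1 - \<mu> + \<mu> * exp s) ^ m" .
  \<comment> \<open>Jensen's inequality for the uniform distribution on the orderings.\<close>
  have exp_le_V: "exp (s * m * subsample_mean n k g y) \<le> V y" for y
  proof -
    let ?b = "\<lambda>\<sigma>. \<Sum>j<m. g (\<lambda>i\<in>{..<k}. y (f \<sigma> j i))"
    have "s * m * subsample_mean n k g y = (\<Sum>\<sigma>\<in>Q. (1 / fact n) *\<^sub>R (s * ?b \<sigma>))"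
      using m unfolding subsample_mean_eq_mean_of_blocks[OF k]
      by (subst sum_distrib_left, intro sum.cong) (auto simp: Q_def f_def m_def)
    also have "exp \<dots> \<le> (\<Sum>\<sigma>\<in>Q. (1 / fact n) * exp (s * ?b \<sigma>))"
      using Q by (intro convex_on_sum[OF _ _ exp_convex]) auto
    also have "\<dots> = V y"
      by (simp add: V_def W_def h_def sum_distrib_left exp_sum)
    finally show ?thesis .
  qed
  have "\<P>(y in ?P. x \<le> subsample_mean n k g y) \<le> \<P>(y in ?P. exp (s * m * x) \<le> V y)"
  proof (rule P.finite_measure_mono)
    show "{y \<in> space ?P. x \<le> subsample_mean n k g y} \<subseteq> {y \<in> space ?P. exp (s * m * x) \<le> V y}"
    proof safe
      fix y assume "x \<le> subsample_mean n k g y"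
      then have "exp (s * m * x) \<le> exp (s * m * subsample_mean n k g y)"
        using s by (simp add: mult_left_mono)
      then show "exp (s * m * x) \<le> V y"
        using exp_le_V[of y] by linarith
    qed
    show "{y \<in> space ?P. exp (s * m * x) \<le> V y} \<in> sets ?P"
      using V_int by measurable
  qed
  also have "\<dots> \<le> (\<integral>y. V y \<partial>?P) / exp (s * m * x)"
    using order_trans[OF exp_ge_zero exp_le_V]
    by (intro integral_Markov_inequality_measure[where A = "{}"] V_int) auto
  also have "\<dots> \<le> (1 - \<mu> + \<mu> * exp s) ^ m / exp (s * m * x)"
    using V_mean by (intro divide_right_mono) auto
  also have "\<dots> = (exp (- (s * x)) * (1 - \<mu> + \<mu> * exp s)) ^ m"
    by (simp add: power_mult_distrib exp_minus field_simps flip: exp_of_nat_mult)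
  finally show ?thesis
    by (simp add: m_def)
qed

text \<open>Hoeffding's inequality for U-statistics, in its divergence form. Only the upper tail is stated: the
lower tail is the upper tail for the kernel \<open>1 - g\<close>, and the divergence is invariant under
exchanging success and failure.\<close>

lemma subsample_mean_tail_KL:
  assumes k: "0 < k" "k \<le> n"
    and g: "g \<in> borel_measurable (\<Pi>\<^sub>M i\<in>{..<k}. M)"
    and g01: "\<And>v. v \<in> space (\<Pi>\<^sub>M i\<in>{..<k}. M) \<Longrightarrow> 0 \<le> g v"
      "\<And>v. v \<in> space (\<Pi>\<^sub>M i\<in>{..<k}. M) \<Longrightarrow> g v \<le> 1"
    and mean: "(\<integral>v. g v \<partial>(\<Pi>\<^sub>M i\<in>{..<k}. M)) \<le> \<mu>"
    and x: "0 \<le> \<mu>" "\<mu> < x" "x < 1"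
  shows "\<P>(y in \<Pi>\<^sub>M i\<in>{..<n}. M. x \<le> subsample_mean n k g y)
    \<le> exp_neg (ereal (real n / (2 * real k)) * KL_bernoulli x \<mu>)"
    (is "?p \<le> _")
proof -
  define m where "m = n div k"
  have m: "0 < m"
    using k by (simp add: m_def div_greater_zero_iff)
  have tail: "?p \<le> (exp (- (s * x)) * (1 - \<mu> + \<mu> * exp s)) ^ m" if "0 \<le> s" for s
    unfolding m_def by (rule subsample_mean_tail_exp[OF k g g01 mean that])
  show ?thesis
  proof (cases "\<mu> = 0")
    case True
    \<comment> \<open>If the mean is \<open>0\<close> the divergence is infinite and no \<open>s\<close> is optimal; let \<open>s\<close> tend to infinity.\<close>
    have "((\<lambda>s. exp (- (s * x)) ^ m) \<longlongrightarrow> 0) at_top"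
      using x m by real_asymp
    then have "?p \<le> 0"
      using tail True by (intro tendsto_lowerbound[where F = at_top]) 
        (auto intro!: eventually_at_top_linorderI[of 0])
    moreover have "exp_neg (ereal (real n / (2 * real k)) * KL_bernoulli x \<mu>) = 0"
      using k x True by (simp add: KL_bernoulli_0)
    ultimately show ?thesis
      by simp
  next
    case False
    then have \<mu>: "0 < \<mu>"
      using x by simp
    define K where "K = x * ln (x / \<mu>) + (1 - x) * ln ((1 - x) / (1 - \<mu>))"
    have K0: "0 \<le> K"
      using KL_bernoulli_quadratic[of x \<mu>] \<mu> x zero_le_power2[of "x - \<mu>"] unfolding K_def
      by linarith
    \<comment> \<open>The minimiser of the exponential bound, whose logarithm there is minus the divergence.\<close>
  define s where "s = ln (x / \<mu>) - ln ((1 - x) / (1 - \<mu>))"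
    have es: "exp s = (x * (1 - \<mu>)) / (\<mu> * (1 - x))"
      using x \<mu> by (simp add: s_def exp_diff)
    have "1 \<le> (x * (1 - \<mu>)) / (\<mu> * (1 - x))"
      using x \<mu> by (simp add: field_simps)
    then have "0 \<le> s"
      unfolding es[symmetric] by simp
    have "1 - \<mu> + \<mu> * exp s = (1 - \<mu>) / (1 - x)"
      unfolding es using x \<mu> by (simp add: field_simps)
    also have "\<dots> = exp (- ln ((1 - x) / (1 - \<mu>)))"
      using x \<mu> by (simp add: exp_minus)
    finally have "exp (- (s * x)) * (1 - \<mu> + \<mu> * exp s) = exp (- K)"
      by (simp add: K_def s_def algebra_simps flip: exp_add)
    then have "?p \<le> exp (- K) ^ m"
      using tail[OF \<open>0 \<le> s\<close>] by simp
    also have "\<dots> = exp (- (m * K))"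
      by (simp flip: exp_of_nat_mult)
    \<comment> \<open>As \<open>k \<le> n\<close>, rounding \<open>n / k\<close> down loses at most a factor 2.\<close>
    also have "real n / (2 * real k) \<le> m"
    proof -
      have "n < (m + 1) * k"
        unfolding m_def using k dividend_less_div_times[of k n] by simp
      also have "\<dots> \<le> 2 * m * k"
        using m by (intro mult_right_mono) auto
      finally have "real n < real (2 * m * k)"
        by (simp only: of_nat_less_iff)
      then show ?thesis
        using k by (simp add: field_simps)
    qed
    then have "exp (- (m * K)) \<le> exp (- (real n / (2 * real k) * K))"
      using K0 by (simp add: mult_right_mono del: times_divide_eq_left)
    finally have "?p \<le> exp (- (real n / (2 * real k) * K))" .
    moreover have "exp_neg (ereal c * KL_bernoulli x \<mu>) = exp (- (c * K))" for c
      using x \<mu> by (simp add: KL_bernoulli_real K_def)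
    ultimately show ?thesis
      by simp
  qed
qed

end

section \<open>Comparing the votes for two decisions\<close>

text \<open>The condition \<open>p + (p - \<eta>) \<le> 1\<close> is \<open>\<eta> \<ge> 2 p - 1\<close>. A probability \<open>p\<close> close to 1 thus
comes with a gap \<open>\<eta>\<close> close to 1, and this is why \<open>1 - p\<close> may replace \<open>p\<close> in the denominator.\<close>

lemma vote_rate_ge:
  fixes p \<eta> :: real
  assumes \<eta>: "0 < \<eta>" "\<eta> \<le> p" and q: "p + (p - \<eta>) \<le> 1"
  shows "\<eta>\<^sup>2 / (min p (1 - p) + 3 * \<eta> / 4) / 24
    \<le> (sqrt (p - \<eta> / 4) - sqrt (p - 3 * \<eta> / 4))\<^sup>2"
proof -
  define a c where "a = p - \<eta> / 4" and "c = p - 3 * \<eta> / 4"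
  define d where "d = min p (1 - p) + 3 * \<eta> / 4"
  have d: "0 < d" "8 * (a + c) \<le> 24 * d"
    using assms by (auto simp: a_def c_def d_def min_def)
  have ac: "0 < a" "0 < c" "a - c = \<eta> / 2"
    using assms by (auto simp: a_def c_def)
  have "\<eta>\<^sup>2 / d / 24 = \<eta>\<^sup>2 / (24 * d)"
    by simp
  also have "\<dots> \<le> \<eta>\<^sup>2 / (8 * (a + c))"
    using d ac by (intro divide_left_mono) auto
  also have "\<dots> = (a - c)\<^sup>2 / (2 * (a + c))"
    unfolding ac(3) by (simp add: power_divide)
  also have "\<dots> \<le> (sqrt a - sqrt c)\<^sup>2"
    using ac by (intro sqrt_diff_square_ge) auto
  finally show ?thesis
    by (simp add: a_def c_def d_def)
qed

context prob_space
begin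

text \<open>Chernoff's method for the difference of the two counts. The tilt \<open>r = sqrt a / sqrt c\<close> minimises
\<open>1 + (r - 1) c + (1 / r - 1) a\<close>, the moment generating function in the extreme case. It depends on
the bounds \<open>a\<close> and \<open>c\<close> alone and not on the actual probabilities, so in the application one tilt
serves all data sets.\<close>

lemma prob_votes_le:
  fixes B :: nat
  assumes P: "Measurable.pred M P" and Q: "Measurable.pred M Q"
    and disj: "\<And>u. u \<in> space M \<Longrightarrow> \<not> (P u \<and> Q u)"
    and p: "\<P>(u in M. P u) \<le> c" and q: "a \<le> \<P>(u in M. Q u)" and ac: "0 < c" "c \<le> a"
  shows "\<P>(v in \<Pi>\<^sub>M b\<in>{..<B}. M. (\<Sum>b<B. of_bool (Q (v b)) :: nat) \<le> (\<Sum>b<B. of_bool (P (v b))))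
    \<le> exp (- (B * (sqrt a - sqrt c)\<^sup>2))"
proof -
  let ?PM = "\<Pi>\<^sub>M b\<in>{..<B}. M"
  interpret PM: prob_space ?PM
    by (rule prob_space_PiM_const)
  interpret product_sigma_finite "\<lambda>_ :: nat. M"
    by standard
  note [measurable] = P Q
  define r where "r = sqrt a / sqrt c"
  have r: "1 \<le> r" "0 < r"
    using ac by (auto simp: r_def)
  define t where "t = ln r"
  have t: "0 \<le> t" "exp t = r" "exp (- t) = 1 / r"
    using r by (auto simp: t_def exp_minus field_simps)
  define h :: "'a \<Rightarrow> real" where "h = (\<lambda>u. exp (t * (of_bool (P u) - of_bool (Q u))))"
  have h_meas[measurable]: "h \<in> borel_measurable M"
    unfolding h_def by measurable
  have h_eq: "h u = 1 + (r - 1) * indicator {u \<in> space M. P u} u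
      + (1 / r - 1) * indicator {u \<in> space M. Q u} u" if "u \<in> space M" for u
    using t disj[OF that] that by (auto simp: h_def)
  have h_int: "integrable M h"
    using t(1) by (intro integrable_const_bound[where B = "exp t"] AE_I2) (auto simp: h_def)
  have "expectation h = 1 + (r - 1) * \<P>(u in M. P u) + (1 / r - 1) * \<P>(u in M. Q u)"
  proof -
    have "expectation h = expectation (\<lambda>u. 1 + (r - 1) * indicator {u \<in> space M. P u} u
        + (1 / r - 1) * indicator {u \<in> space M. Q u} u)"
      by (intro Bochner_Integration.integral_cong refl h_eq)
    then show ?thesis
      by (simp add: prob_space emeasure_eq_measure)
  qed
  also have "\<dots> \<le> 1 + (r - 1) * c + (1 / r - 1) * a"
    using r p q by (intro add_mono mult_left_mono mult_left_mono_neg) auto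
  also have "\<dots> = 1 - (sqrt a - sqrt c)\<^sup>2"
    using ac real_sqrt_mult_self[of a] real_sqrt_mult_self[of c]
    by (simp add: r_def power2_eq_square field_simps)
  also have "\<dots> \<le> exp (- (sqrt a - sqrt c)\<^sup>2)"
    using exp_ge_add_one_self[of "- (sqrt a - sqrt c)\<^sup>2"] by simp
  finally have h_mean: "expectation h \<le> exp (- (sqrt a - sqrt c)\<^sup>2)" .
  define Y where "Y = (\<lambda>v :: nat \<Rightarrow> 'a. \<Prod>b<B. h (v b))"
  have Y_int: "integrable ?PM Y"
    unfolding Y_def by (rule product_integrable_prod) (auto intro: h_int)
  have "(\<integral>v. Y v \<partial>?PM) = expectation h ^ B"
    unfolding Y_def by (subst product_integral_prod) (auto intro: h_int)
  also have "\<dots> \<le> exp (- (sqrt a - sqrt c)\<^sup>2) ^ B"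
    using h_mean by (intro power_mono integral_nonneg_AE) (auto simp: h_def)
  also have "\<dots> = exp (- (B * (sqrt a - sqrt c)\<^sup>2))"
    by (simp flip: exp_of_nat_mult)
  finally have Y_mean: "(\<integral>v. Y v \<partial>?PM) \<le> exp (- (B * (sqrt a - sqrt c)\<^sup>2))" .
  have Y_ge: "1 \<le> Y v" if "(\<Sum>b<B. of_bool (Q (v b)) :: nat) \<le> (\<Sum>b<B. of_bool (P (v b)))" for v
  proof -
    have "real (\<Sum>b<B. of_bool (Q (v b))) \<le> real (\<Sum>b<B. of_bool (P (v b)))"
      using that by (simp only: of_nat_le_iff)
    then have "0 \<le> t * (\<Sum>b<B. of_bool (P (v b)) - of_bool (Q (v b)))"
      using t by (intro mult_nonneg_nonneg) (simp_all add: sum_subtractf)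
    then show ?thesis
      by (simp add: Y_def h_def sum_distrib_left flip: exp_sum)
  qed
  have "\<P>(v in ?PM. (\<Sum>b<B. of_bool (Q (v b)) :: nat) \<le> (\<Sum>b<B. of_bool (P (v b))))
      \<le> \<P>(v in ?PM. 1 \<le> Y v)"
    using Y_ge Y_int by (intro PM.finite_measure_mono) auto
  also have "\<dots> \<le> (\<integral>v. Y v \<partial>?PM) / 1"
  proof (rule integral_Markov_inequality_measure[where A = "{}", OF Y_int])
    show "AE v in ?PM. 0 \<le> Y v"
      by (intro AE_I2) (simp add: Y_def h_def prod_nonneg)
  qed auto
  also note Y_mean
  finally show ?thesis
    by simp
qed

end

text \<open>Fubini's theorem used as conditioning on the first component.\<close>

lemma measure_pair_le_except:
  assumes M: "prob_space M" and N: "prob_space N"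
    and W: "W \<in> sets (M \<Otimes>\<^sub>M N)" and E: "E \<in> sets M" and c: "0 \<le> c"
    and le: "\<And>y. y \<in> space M \<Longrightarrow> y \<notin> E \<Longrightarrow> measure N (Pair y -` W) \<le> c"
  shows "measure (M \<Otimes>\<^sub>M N) W \<le> measure M E + c"
proof -
  interpret M: prob_space M by fact
  interpret N: prob_space N by fact
  interpret MN: pair_prob_space M N ..
  have "emeasure (M \<Otimes>\<^sub>M N) W = (\<integral>\<^sup>+y. emeasure N (Pair y -` W) \<partial>M)"
    by (rule N.emeasure_pair_measure_alt[OF W])
  also have "\<dots> \<le> (\<integral>\<^sup>+y. indicator E y + ennreal c \<partial>M)"
  proof (rule nn_integral_mono)
    fix y assume y: "y \<in> space M"
    show "emeasure N (Pair y -` W) \<le> indicator E y + ennreal c"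
    proof (cases "y \<in> E")
      case True
      then show ?thesis
        using N.emeasure_le_1[of "Pair y -` W"] by (simp add: add_increasing2)
    next
      case False
      then show ?thesis
        using le[OF y] by (simp add: N.emeasure_eq_measure ennreal_leI)
    qed
  qed
  also have "\<dots> = ennreal (measure M E + c)"
    using E c by (simp add: nn_integral_add M.prob_space M.emeasure_eq_measure ennreal_plus)
  finally show ?thesis
    using c by (simp add: MN.emeasure_eq_measure flip: ennreal_plus)
qed

section \<open>Majority voting over subsamples\<close>

context MoVE
begin

abbreviation "data_law \<equiv> \<Pi>\<^sub>M i\<in>{..<n}. D"
abbreviation "round_law \<equiv> uniform_count_measure (subsamples n k) \<Otimes>\<^sub>M R"
abbreviation "rounds_law \<equiv> \<Pi>\<^sub>M b\<in>{..<B}. round_law"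

definition vote :: "(nat \<Rightarrow> 'z) \<Rightarrow> nat list \<times> 'w \<Rightarrow> 't" where
  "vote y u = A (map y (fst u)) (snd u)"

text \<open>The probability, over the algorithmic randomness alone, that the learner selects \<open>\<theta>\<close> on the data
\<open>v\<close>. Averaging out this randomness first turns the learner into a kernel for a U-statistic.\<close>

definition selection_prob :: "'t \<Rightarrow> (nat \<Rightarrow> 'z) \<Rightarrow> real" where
  "selection_prob \<theta> v = (\<integral>\<omega>. of_bool (\<theta> = A (map v [0..<k]) \<omega>) \<partial>R)"

lemma subsamples_nonempty: "subsamples n k \<noteq> {}"
  using upt_in_subsamples[of 0 k n] subsample_size by auto

lemma prob_space_round_law: "prob_space round_law"
  using finite_subsamples subsamples_nonempty
  by (intro prob_space_pair prob_space_uniform_count_measure noise.prob_space_axioms)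

lemma learner_pred:
  assumes "\<theta> \<in> \<Theta>"
  shows "Measurable.pred ((\<Pi>\<^sub>M i\<in>{..<k}. D) \<Otimes>\<^sub>M R) (\<lambda>y. \<theta> = A (map (fst y) [0..<k]) (snd y))"
  using measurable_compose[OF learner_measurable[OF subsample_size(1)], of "\<lambda>\<theta>'. \<theta> = \<theta>'" "count_space UNIV"]
  by simp

lemma measurable_selection_prob:
  assumes "\<theta> \<in> \<Theta>"
  shows "selection_prob \<theta> \<in> borel_measurable (\<Pi>\<^sub>M i\<in>{..<k}. D)"
  unfolding selection_prob_def
  using learner_pred[OF assms]
  by (intro noise.borel_measurable_lebesgue_integral) (simp add: case_prod_beta')

lemma selection_prob_bounds:
  "0 \<le> selection_prob \<theta> v" "selection_prob \<theta> v \<le> 1"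
proof -
  show "0 \<le> selection_prob \<theta> v"
    unfolding selection_prob_def by (rule integral_nonneg_AE) simp
  have "selection_prob \<theta> v \<le> (\<integral>\<omega>. 1 \<partial>R)"
    unfolding selection_prob_def by (rule integral_mono') auto
  then show "selection_prob \<theta> v \<le> 1"
    by (simp add: noise.prob_space)
qed

lemma integral_selection_prob:
  assumes "\<theta> \<in> \<Theta>"
  shows "(\<integral>v. selection_prob \<theta> v \<partial>(\<Pi>\<^sub>M i\<in>{..<k}. D)) = learner_prob D R A k \<theta>"
proof -
  let ?K = "\<Pi>\<^sub>M i\<in>{..<k}. D"
  interpret K: prob_space ?K
    by (rule data.prob_space_PiM_const)
  interpret KR: pair_prob_space ?K R ..
  let ?f = "\<lambda>y. of_bool (\<theta> = A (map (fst y) [0..<k]) (snd y)) :: real"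
  have "integrable (?K \<Otimes>\<^sub>M R) ?f"
    using learner_pred[OF assms] by (intro KR.integrable_const_bound[where B = 1] AE_I2) auto
  from KR.integral_fst'[OF this]
  have "(\<integral>v. selection_prob \<theta> v \<partial>?K) = (\<integral>y. ?f y \<partial>(?K \<Otimes>\<^sub>M R))"
    by (simp add: selection_prob_def)
  also have "\<dots> = (\<integral>y. indicator {y \<in> space (?K \<Otimes>\<^sub>M R). \<theta> = A (map (fst y) [0..<k]) (snd y)} y \<partial>(?K \<Otimes>\<^sub>M R))"
    by (intro Bochner_Integration.integral_cong) auto
  also have "\<dots> = learner_prob D R A k \<theta>"
    using learner_pred[OF assms] by (simp add: learner_prob_def)
  finally show ?thesis .
qed

text \<open>The learner is assumed to be measurable only for data in a fixed order. Joint measurability in the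
subsample as well follows since there are finitely many subsamples.\<close>

lemma measurable_vote:
  "(\<lambda>(y, u). vote y u) \<in> data_law \<Otimes>\<^sub>M round_law \<rightarrow>\<^sub>M count_space \<Theta>"
proof -
  have fixed: "(\<lambda>p. A (map (fst p) is) (snd (snd p))) \<in> data_law \<Otimes>\<^sub>M round_law \<rightarrow>\<^sub>M count_space \<Theta>"
    if "is": "is \<in> subsamples n k" for "is"
  proof -
    have len: "length is = k" and "(!) is ` {..<k} \<subseteq> {..<n}"
      using "is" nth_mem[of _ "is"] unfolding subsamples_def by blast+
    from data.measurable_subfamily[OF this(2)]
    have "(\<lambda>p. (\<lambda>i\<in>{..<k}. fst p (is ! i), snd (snd p)))
        \<in> data_law \<Otimes>\<^sub>M round_law \<rightarrow>\<^sub>M (\<Pi>\<^sub>M i\<in>{..<k}. D) \<Otimes>\<^sub>M R"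
      by measurable
    from measurable_compose[OF this learner_measurable[OF subsample_size(1)]]
    have F: "(\<lambda>p. A (map (\<lambda>i\<in>{..<k}. fst p (is ! i)) [0..<k]) (snd (snd p)))
        \<in> data_law \<Otimes>\<^sub>M round_law \<rightarrow>\<^sub>M count_space \<Theta>"
      by simp
    have eq: "map (\<lambda>i\<in>{..<k}. fst p (is ! i)) [0..<k] = map (fst p) is"
      for p :: "(nat \<Rightarrow> 'z) \<times> nat list \<times> 'w"
      using len by (intro nth_equalityI) auto
    show ?thesis
      using F unfolding eq .
  qed
  have "(\<lambda>p. fst (snd p)) \<in> data_law \<Otimes>\<^sub>M round_law \<rightarrow>\<^sub>M count_space (subsamples n k)"
    by measurable
  from measurable_compose_countable'[OF fixed this countable_finite[OF finite_subsamples]]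
  have "(\<lambda>p. A (map (fst p) (fst (snd p))) (snd (snd p)))
      \<in> data_law \<Otimes>\<^sub>M round_law \<rightarrow>\<^sub>M count_space \<Theta>" .
  then show ?thesis
    by (simp add: vote_def case_prod_beta')
qed

lemma pred_vote_pair:
  assumes "\<theta> \<in> \<Theta>"
  shows "Measurable.pred (data_law \<Otimes>\<^sub>M round_law) (\<lambda>p. \<theta> = vote (fst p) (snd p))"
  using measurable_compose[OF measurable_vote, of "\<lambda>\<theta>'. \<theta> = \<theta>'" "count_space UNIV"]
  by (simp add: case_prod_beta')

lemma pred_vote:
  assumes "\<theta> \<in> \<Theta>" "y \<in> space data_law"
  shows "Measurable.pred round_law (\<lambda>u. \<theta> = vote y u)"
  using measurable_compose[OF measurable_Pair1'[OF assms(2)] pred_vote_pair[OF assms(1)]] by simp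

text \<open>Given the data, each round votes for \<open>\<theta>\<close> with a probability that is a U-statistic of the data.\<close>

lemma prob_vote:
  assumes \<theta>: "\<theta> \<in> \<Theta>" and y: "y \<in> space data_law"
  shows "\<P>(u in round_law. \<theta> = vote y u) = subsample_mean n k (selection_prob \<theta>) y"
proof -
  let ?S = "uniform_count_measure (subsamples n k)"
  interpret S: prob_space ?S
    using finite_subsamples subsamples_nonempty by (rule prob_space_uniform_count_measure)
  interpret SR: pair_prob_space ?S R ..
  let ?f = "\<lambda>u. of_bool (\<theta> = vote y u) :: real"
  have "\<P>(u in round_law. \<theta> = vote y u) = (\<integral>u. indicator {u \<in> space round_law. \<theta> = vote y u} u \<partial>round_law)"
    using pred_vote[OF \<theta> y] by simp
  also have "\<dots> = (\<integral>u. ?f u \<partial>round_law)"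
    by (intro Bochner_Integration.integral_cong) auto
  also have "\<dots> = (\<integral>is. \<integral>\<omega>. ?f (is, \<omega>) \<partial>R \<partial>?S)"
    using pred_vote[OF \<theta> y]
    by (intro SR.integral_fst'[symmetric] SR.integrable_const_bound[where B = 1] AE_I2) auto
  also have "\<dots> = (\<Sum>is\<in>subsamples n k. \<integral>\<omega>. ?f (is, \<omega>) \<partial>R) / card (subsamples n k)"
    by (rule integral_uniform_count_measure[OF finite_subsamples])
  also have "(\<Sum>is\<in>subsamples n k. \<integral>\<omega>. ?f (is, \<omega>) \<partial>R)
      = (\<Sum>is\<in>subsamples n k. selection_prob \<theta> (\<lambda>i\<in>{..<k}. y (is ! i)))"
  proof (rule sum.cong[OF refl])
    fix "is" assume "is \<in> subsamples n k"
    then have "map (\<lambda>i\<in>{..<k}. y (is ! i)) [0..<k] = map y is"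
      by (intro nth_equalityI) (auto simp: subsamples_def)
    then show "(\<integral>\<omega>. ?f (is, \<omega>) \<partial>R) = selection_prob \<theta> (\<lambda>i\<in>{..<k}. y (is ! i))"
      by (simp add: selection_prob_def vote_def)
  qed
  finally show ?thesis
    by (simp add: subsample_mean_def)
qed

lemma max_prob_attained:
  obtains \<theta> where "\<theta> \<in> \<Theta>" "learner_prob D R A k \<theta> = max_prob D R A \<Theta> k"
proof -
  have "max_prob D R A \<Theta> k \<in> learner_prob D R A k ` \<Theta>"
    unfolding max_prob_def using finite_space nonempty_space by (intro Max_in) auto
  then show thesis
    using that by auto
qed

lemma learner_prob_bad_le:
  assumes "\<theta> \<in> \<Theta> - near_optimal D l \<Theta> \<delta>"
  shows "learner_prob D R A k \<theta> \<le> max_prob_bad D R l A \<Theta> k \<delta>"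
  using assms finite_space unfolding max_prob_bad_def by (auto intro!: Max_ge)

lemma max_prob_bad_nonneg: "0 \<le> max_prob_bad D R l A \<Theta> k \<delta>"
proof (cases "\<Theta> - near_optimal D l \<Theta> \<delta> = {}")
  case False
  then obtain \<theta> where \<theta>: "\<theta> \<in> \<Theta> - near_optimal D l \<Theta> \<delta>"
    by blast
  have "0 \<le> learner_prob D R A k \<theta>"
    by (simp add: learner_prob_def)
  then show ?thesis
    using learner_prob_bad_le[OF \<theta>] by linarith
qed (simp add: max_prob_bad_def)

text \<open>A positive gap means that the two maxima are attained at different decisions, which are selected on
disjoint events.\<close>

lemma max_prob_add_bad_le_1:
  assumes "0 < eta D R l A \<Theta> k \<delta>"
  shows "max_prob D R A \<Theta> k + max_prob_bad D R l A \<Theta> k \<delta> \<le> 1"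
proof -
  let ?KR = "(\<Pi>\<^sub>M i\<in>{..<k}. D) \<Otimes>\<^sub>M R"
  interpret KR: prob_space ?KR
    by (intro prob_space_pair data.prob_space_PiM_const noise.prob_space_axioms)
  obtain \<theta>s where \<theta>s: "\<theta>s \<in> \<Theta>" "learner_prob D R A k \<theta>s = max_prob D R A \<Theta> k"
    using max_prob_attained .
  show ?thesis
  proof (cases "\<Theta> - near_optimal D l \<Theta> \<delta> = {}")
    case True
    have "learner_prob D R A k \<theta>s \<le> 1"
      by (simp add: learner_prob_def)
    then show ?thesis
      using True \<theta>s by (simp add: max_prob_bad_def)
  next
    case False
    then have "max_prob_bad D R l A \<Theta> k \<delta>
        = Max (learner_prob D R A k ` (\<Theta> - near_optimal D l \<Theta> \<delta>))"
      by (simp add: max_prob_bad_def)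
    also have "\<dots> \<in> learner_prob D R A k ` (\<Theta> - near_optimal D l \<Theta> \<delta>)"
      using False finite_space by (intro Max_in) auto
    finally obtain \<theta> where \<theta>: "\<theta> \<in> \<Theta>" "learner_prob D R A k \<theta> = max_prob_bad D R l A \<Theta> k \<delta>"
      by auto
    then have "\<theta> \<noteq> \<theta>s"
      using assms \<theta>s by (auto simp: eta_def)
    then have "learner_prob D R A k \<theta>s + learner_prob D R A k \<theta>
        = \<P>(y in ?KR. \<theta>s = A (map (fst y) [0..<k]) (snd y) \<or> \<theta> = A (map (fst y) [0..<k]) (snd y))"
      unfolding learner_prob_def using learner_pred[OF \<theta>s(1)] learner_pred[OF \<theta>(1)]
      by (subst KR.finite_measure_Union[symmetric]) (auto intro!: arg_cong[of _ _ KR.prob])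
    also have "\<dots> \<le> 1"
      by simp
    finally show ?thesis
      using \<theta>s \<theta> by simp
  qed
qed

definition votes :: "'t \<Rightarrow> (nat \<Rightarrow> 'z) \<times> (nat \<Rightarrow> nat list \<times> 'w) \<Rightarrow> nat" where
  "votes \<theta> p = (\<Sum>b<B. of_bool (\<theta> = vote (fst p) (snd p b)))"

lemma measurable_votes:
  assumes "\<theta> \<in> \<Theta>"
  shows "votes \<theta> \<in> data_law \<Otimes>\<^sub>M rounds_law \<rightarrow>\<^sub>M count_space UNIV"
  unfolding votes_def
proof (rule measurable_sum_nat)
  fix b assume "b \<in> {..<B}"
  then have "(\<lambda>p. (fst p, snd p b)) \<in> data_law \<Otimes>\<^sub>M rounds_law \<rightarrow>\<^sub>M data_law \<Otimes>\<^sub>M round_law"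
    by measurable
  from measurable_compose[OF this pred_vote_pair[OF assms]]
  have "Measurable.pred (data_law \<Otimes>\<^sub>M rounds_law) (\<lambda>p. \<theta> = vote (fst p) (snd p b))"
    by simp
  then show "(\<lambda>p. of_bool (\<theta> = vote (fst p) (snd p b)) :: nat)
      \<in> data_law \<Otimes>\<^sub>M rounds_law \<rightarrow>\<^sub>M count_space UNIV"
    by measurable
qed

lemma outvotes_event:
  assumes "\<theta> \<in> \<Theta>" "\<theta>' \<in> \<Theta>"
  shows "{x \<in> space (data_law \<Otimes>\<^sub>M rounds_law). votes \<theta>' x \<le> votes \<theta> x} \<in> sets (data_law \<Otimes>\<^sub>M rounds_law)"
proof -
  have "(\<lambda>x. real (votes \<theta> x)) \<in> borel_measurable (data_law \<Otimes>\<^sub>M rounds_law)" if "\<theta> \<in> \<Theta>" for \<theta>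
    by (rule measurable_compose[OF measurable_votes[OF that]]) simp
  from borel_measurable_le[OF this[OF assms(2)] this[OF assms(1)]] show ?thesis
    by simp
qed

text \<open>Split on the data: outside two exceptional events, on which one of the two conditional vote
probabilities deviates by \<open>\<eta> / 4\<close> from its mean in the unfavourable direction, these probabilities
are still more than \<open>\<eta> / 2\<close> apart, and the votes are independent given the data.\<close>

lemma prob_bad_outvotes_le:
  fixes p \<eta> :: real
  assumes \<theta>: "\<theta> \<in> \<Theta>" "learner_prob D R A k \<theta> \<le> p - \<eta>"
    and \<theta>s: "\<theta>s \<in> \<Theta>" "learner_prob D R A k \<theta>s = p"
    and \<eta>: "0 < \<eta>" "\<eta> \<le> p" "p + (p - \<eta>) \<le> 1"
  shows "\<P>(x in data_law \<Otimes>\<^sub>M rounds_law. votes \<theta>s x \<le> votes \<theta> x)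
    \<le> exp_neg (ereal (real n / (2 * real k)) * KL_bernoulli (p - 3 * \<eta> / 4) (p - \<eta>))
      + exp_neg (ereal (real n / (2 * real k)) * KL_bernoulli (p - \<eta> / 4) p)
      + exp (- (B / 24) * (\<eta>\<^sup>2 / (min p (1 - p) + 3 * \<eta> / 4)))"
proof -
  let ?J = "data_law \<Otimes>\<^sub>M rounds_law"
  interpret Dn: prob_space data_law
    by (rule data.prob_space_PiM_const)
  interpret round: prob_space round_law
    by (rule prob_space_round_law)
  interpret K: prob_space "\<Pi>\<^sub>M i\<in>{..<k}. D"
    by (rule data.prob_space_PiM_const)
  define U where "U = (\<lambda>\<theta>. subsample_mean n k (selection_prob \<theta>))"
  \<comment> \<open>The kernel of the lower tail of the vote probability of \<open>\<theta>s\<close>.\<close>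
  define g where "g = (\<lambda>v. 1 - selection_prob \<theta>s v)"
  have g_meas: "g \<in> borel_measurable (\<Pi>\<^sub>M i\<in>{..<k}. D)"
    unfolding g_def using measurable_selection_prob[OF \<theta>s(1)] by measurable
  have "integrable (\<Pi>\<^sub>M i\<in>{..<k}. D) (selection_prob \<theta>s)"
    using measurable_selection_prob[OF \<theta>s(1)] selection_prob_bounds
    by (intro K.integrable_const_bound[where B = 1] AE_I2) auto
  then have g_mean: "(\<integral>v. g v \<partial>(\<Pi>\<^sub>M i\<in>{..<k}. D)) = 1 - p"
    using integral_selection_prob[OF \<theta>s(1)] \<theta>s(2) K.prob_space by (simp add: g_def)
  have U_g: "subsample_mean n k g y = 1 - U \<theta>s y" for y
  proof -
    have "card (subsamples n k) \<noteq> 0"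
      using finite_subsamples subsamples_nonempty by simp
    then show ?thesis
      by (simp add: subsample_mean_def U_def g_def sum_subtractf diff_divide_distrib)
  qed
  define E1 where "E1 = {y \<in> space data_law. p - 3 * \<eta> / 4 \<le> U \<theta> y}"
  define E2 where "E2 = {y \<in> space data_law. 1 - (p - \<eta> / 4) \<le> subsample_mean n k g y}"
  have E1: "E1 \<in> sets data_law"
    unfolding E1_def U_def using data.measurable_subsample_mean[OF measurable_selection_prob[OF \<theta>(1)]]
    by measurable
  have E2: "E2 \<in> sets data_law"
    unfolding E2_def using data.measurable_subsample_mean[OF g_meas] by measurable
  have "measure data_law E1
      \<le> exp_neg (ereal (real n / (2 * real k)) * KL_bernoulli (p - 3 * \<eta> / 4) (p - \<eta>))"
    unfolding E1_def U_def
    using subsample_size measurable_selection_prob[OF \<theta>(1)] selection_prob_bounds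
      integral_selection_prob[OF \<theta>(1)] \<theta>(2) \<eta>
    by (intro data.subsample_mean_tail_KL) auto
  moreover have "measure data_law E2
      \<le> exp_neg (ereal (real n / (2 * real k)) * KL_bernoulli (1 - (p - \<eta> / 4)) (1 - p))"
    unfolding E2_def
    using subsample_size g_meas selection_prob_bounds g_mean \<eta>
    by (intro data.subsample_mean_tail_KL) (auto simp: g_def)
  moreover have "measure ?J {x \<in> space ?J. votes \<theta>s x \<le> votes \<theta> x} \<le> measure data_law (E1 \<union> E2)
      + exp (- (B / 24) * (\<eta>\<^sup>2 / (min p (1 - p) + 3 * \<eta> / 4)))"
  proof (rule measure_pair_le_except)
    show "prob_space rounds_law"
      by (rule round.prob_space_PiM_const)
    show "{x \<in> space ?J. votes \<theta>s x \<le> votes \<theta> x} \<in> sets ?J"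
      by (rule outvotes_event[OF \<theta>(1) \<theta>s(1)])
    fix y assume y: "y \<in> space data_law" "y \<notin> E1 \<union> E2"
    have "\<P>(v in rounds_law. (\<Sum>b<B. of_bool (\<theta>s = vote y (v b)) :: nat) \<le> (\<Sum>b<B. of_bool (\<theta> = vote y (v b))))
      \<le> exp (- (B * (sqrt (p - \<eta> / 4) - sqrt (p - 3 * \<eta> / 4))\<^sup>2))"
    proof (rule round.prob_votes_le)
      show "\<P>(u in round_law. \<theta> = vote y u) \<le> p - 3 * \<eta> / 4"
        using y by (simp add: prob_vote[OF \<theta>(1) y(1)] E1_def U_def)
      show "p - \<eta> / 4 \<le> \<P>(u in round_law. \<theta>s = vote y u)"
        using y by (simp add: prob_vote[OF \<theta>s(1) y(1)] E2_def U_g) (simp add: U_def)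
      show "\<not> (\<theta> = vote y u \<and> \<theta>s = vote y u)" for u
        using \<theta> \<theta>s \<eta> by auto
    qed (use pred_vote[OF \<theta>(1) y(1)] pred_vote[OF \<theta>s(1) y(1)] \<eta> in auto)
    also have "\<dots> \<le> exp (- (B / 24) * (\<eta>\<^sup>2 / (min p (1 - p) + 3 * \<eta> / 4)))"
      using mult_left_mono[OF vote_rate_ge[OF \<eta>], of B] by (simp add: mult.commute)
    finally have "\<P>(v in rounds_law. votes \<theta>s (y, v) \<le> votes \<theta> (y, v))
        \<le> exp (- (B / 24) * (\<eta>\<^sup>2 / (min p (1 - p) + 3 * \<eta> / 4)))"
      by (simp add: votes_def)
    moreover have "Pair y -` {x \<in> space ?J. votes \<theta>s x \<le> votes \<theta> x}
        = {v \<in> space rounds_law. votes \<theta>s (y, v) \<le> votes \<theta> (y, v)}"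
      using y by (auto simp: space_pair_measure)
    ultimately show "measure rounds_law (Pair y -` {x \<in> space ?J. votes \<theta>s x \<le> votes \<theta> x})
        \<le> exp (- (B / 24) * (\<eta>\<^sup>2 / (min p (1 - p) + 3 * \<eta> / 4)))"
      by simp
  qed (use E1 E2 Dn.prob_space_axioms in auto)
  moreover have "measure data_law (E1 \<union> E2) \<le> measure data_law E1 + measure data_law E2"
    using E1 E2 by (intro measure_Un_le) auto
  ultimately show ?thesis
    by (simp add: KL_bernoulli_complement)
qed

definition run :: "'s \<Rightarrow> (nat \<Rightarrow> 'z) \<times> (nat \<Rightarrow> nat list \<times> 'w)" where
  "run x = (\<lambda>i\<in>{..<n}. z i x, \<lambda>b\<in>{..<B}. (idx b x, w b x))"

lemma measurable_run: "run \<in> M \<rightarrow>\<^sub>M data_law \<Otimes>\<^sub>M rounds_law"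
  unfolding run_def using z_measurable idx_measurable w_measurable
  by (intro measurable_Pair measurable_restrict) auto

lemma votes_run:
  assumes "x \<in> space M"
  shows "votes \<theta> (run x) = (\<Sum>b<B. of_bool (\<theta> = A (map (\<lambda>i. z i x) (idx b x)) (w b x)))"
proof -
  have "vote (fst (run x)) (snd (run x) b) = A (map (\<lambda>i. z i x) (idx b x)) (w b x)" if "b < B" for b
  proof -
    have "idx b x \<in> subsamples n k"
      using measurable_space[OF idx_measurable[OF that] assms] by (simp add: space_uniform_count_measure)
    then have "map (fst (run x)) (idx b x) = map (\<lambda>i. z i x) (idx b x)"
      by (intro map_cong refl) (auto simp: subsamples_def run_def)
    moreover have "snd (run x) b = (idx b x, w b x)"
      using that by (simp add: run_def)
    ultimately show ?thesis
      by (simp only: vote_def fst_conv snd_conv)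
  qed
  then show ?thesis
    by (simp add: votes_def)
qed

text \<open>If the output is not \<open>\<delta>\<close>-optimal, it has at least as many votes as a fixed most likely decision
\<open>\<theta>s\<close>, however ties are broken; so a union bound over the candidates suffices.\<close>

lemma prob_output_bad_le:
  fixes p \<eta> :: real
  assumes gap: "0 < eta D R l A \<Theta> k \<delta>"
  defines "p \<equiv> max_prob D R A \<Theta> k" and "\<eta> \<equiv> eta D R l A \<Theta> k \<delta>"
  shows "\<P>(x in M. (MIN \<theta>\<in>\<Theta>. risk D l \<theta>) + \<delta> < risk D l (out x))
    \<le> card \<Theta> * (exp_neg (ereal (real n / (2 * real k)) * KL_bernoulli (p - 3 * \<eta> / 4) (p - \<eta>))
      + exp_neg (ereal (real n / (2 * real k)) * KL_bernoulli (p - \<eta> / 4) p)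
      + exp (- (B / 24) * (\<eta>\<^sup>2 / (min p (1 - p) + 3 * \<eta> / 4))))"
    (is "?lhs \<le> _ * ?bound")
proof -
  define bad where "bad = \<Theta> - near_optimal D l \<Theta> \<delta>"
  have \<eta>: "0 < \<eta>" "\<eta> \<le> p" "p + (p - \<eta>) \<le> 1"
    using gap max_prob_bad_nonneg[of \<delta>] max_prob_add_bad_le_1[OF gap]
    by (auto simp: p_def \<eta>_def eta_def)
  obtain \<theta>s where \<theta>s: "\<theta>s \<in> \<Theta>" "learner_prob D R A k \<theta>s = p"
    using max_prob_attained unfolding p_def .
  let ?J = "data_law \<Otimes>\<^sub>M rounds_law"
  let ?W = "\<lambda>\<theta>. {x \<in> space ?J. votes \<theta>s x \<le> votes \<theta> x}"
  have W: "?W \<theta> \<in> sets ?J" if "\<theta> \<in> bad" for \<theta>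
    using that \<theta>s(1) by (intro outvotes_event) (auto simp: bad_def)
  have "finite bad"
    using finite_space by (simp add: bad_def)
  have "?lhs \<le> measure M (\<Union>\<theta>\<in>bad. run -` ?W \<theta> \<inter> space M)"
  proof (rule finite_measure_mono)
    show "(\<Union>\<theta>\<in>bad. run -` ?W \<theta> \<inter> space M) \<in> sets M"
      using W measurable_run \<open>finite bad\<close> by (intro sets.finite_UN) (auto intro: measurable_sets)
    show "{x \<in> space M. (MIN \<theta>\<in>\<Theta>. risk D l \<theta>) + \<delta> < risk D l (out x)}
        \<subseteq> (\<Union>\<theta>\<in>bad. run -` ?W \<theta> \<inter> space M)"
    proof safe
      fix x assume x: "x \<in> space M" "(MIN \<theta>\<in>\<Theta>. risk D l \<theta>) + \<delta> < risk D l (out x)"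
      have "out x \<in> bad"
        using x out_majority[OF x(1)] by (auto simp: bad_def near_optimal_def is_arg_max_def)
      moreover have "votes \<theta>s (run x) \<le> votes (out x) (run x)"
        using out_majority[OF x(1)] \<theta>s(1) by (auto simp: votes_run[OF x(1)] is_arg_max_def not_less)
      ultimately show "x \<in> (\<Union>\<theta>\<in>bad. run -` ?W \<theta> \<inter> space M)"
        using x measurable_space[OF measurable_run x(1)] by auto
    qed
  qed
  also have "\<dots> \<le> (\<Sum>\<theta>\<in>bad. measure M (run -` ?W \<theta> \<inter> space M))"
    using W measurable_run \<open>finite bad\<close>
    by (intro finite_measure_subadditive_finite) (auto intro: measurable_sets)
  also have "\<dots> \<le> (\<Sum>\<theta>\<in>bad. ?bound)"
  proof (rule sum_mono)
    fix \<theta> assume \<theta>: "\<theta> \<in> bad"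
    have "measure M (run -` ?W \<theta> \<inter> space M) = measure (distr M ?J run) (?W \<theta>)"
      by (rule measure_distr[OF measurable_run W[OF \<theta>], symmetric])
    also have "distr M ?J run = ?J"
      using joint_law by (simp add: run_def[abs_def])
    also have "measure ?J (?W \<theta>) \<le> ?bound"
      using \<theta> learner_prob_bad_le[of \<theta> \<delta>]
      by (intro prob_bad_outvotes_le \<theta>s \<eta>) (auto simp: bad_def p_def \<eta>_def eta_def)
    finally show "measure M (run -` ?W \<theta> \<inter> space M) \<le> ?bound" .
  qed
  also have "\<dots> = card bad * ?bound"
    by simp
  also have "\<dots> \<le> card \<Theta> * ?bound"
    using finite_space exp_neg_nonneg by (intro mult_right_mono add_nonneg_nonneg) (auto simp: bad_def card_mono)
  finally show ?thesis .
qed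

end

theorem theoremB7:
  "\<exists>C1 C2 C3 :: real. 0 < C1 \<and> 0 < C2 \<and> 0 < C3 \<and>
     (\<forall>(M :: 's measure) (D :: 'z measure) (R :: 'w measure) (\<Theta> :: 't set) l A n k B z idx w out \<delta>.
        MoVE M D R \<Theta> l A n k B z idx w out \<and> 0 \<le> \<delta> \<and> 0 < eta D R l A \<Theta> k \<delta> \<longrightarrow>
          \<P>(x in M. (MIN \<theta>\<in>\<Theta>. risk D l \<theta>) + \<delta> < risk D l (out x))
            \<le> MoVE_bound (card \<Theta>) n k B (max_prob D R A \<Theta> k) (eta D R l A \<Theta> k \<delta>) \<and>
          (4 / 5 < eta D R l A \<Theta> k \<delta> \<longrightarrow>
            MoVE_bound (card \<Theta>) n k B (max_prob D R A \<Theta> k) (eta D R l A \<Theta> k \<delta>)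
              \<le> MoVE_simple_bound C1 C2 C3 (card \<Theta>) n k B
                   (max_prob D R A \<Theta> k) (max_prob_bad D R l A \<Theta> k \<delta>))) \<and>
     (\<forall>(N :: nat) (n :: nat) (k :: nat) (B :: nat) (p :: real) (q :: real).
        0 < k \<and> k \<le> n \<and> 0 \<le> q \<and> p + q \<le> 1 \<and> 4 / 5 < p - q \<longrightarrow>
          MoVE_bound N n k B p (p - q) \<le> MoVE_simple_bound C1 C2 C3 N n k B p q)"
proof (intro exI conjI allI impI)
  show "0 < exp (5 :: real)" "0 < (80 :: real)" "0 < (30 :: real)"
    by simp_all
next
  fix M :: "'s measure" and D :: "'z measure" and R :: "'w measure" and \<Theta> :: "'t set"
    and l A n k B z idx w out \<delta>
  assume *: "MoVE M D R \<Theta> l A n k B z idx w out \<and> 0 \<le> \<delta> \<and> 0 < eta D R l A \<Theta> k \<delta>"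
  then interpret MoVE M D R \<Theta> l A n k B z idx w out
    by simp
  have gap: "0 < eta D R l A \<Theta> k \<delta>"
    using * by simp
  note prob_output_bad_le[OF gap]
  also have "real (card \<Theta>) * (a + b + c) \<le> real (card \<Theta>) * (a + 2 * b + c + of_bool P * d)"
    if "0 \<le> b" "0 \<le> d" for a b c d and P
    using that by (intro mult_left_mono) auto
  note this[OF exp_neg_nonneg exp_neg_nonneg]
  finally show "\<P>(x in M. (MIN \<theta>\<in>\<Theta>. risk D l \<theta>) + \<delta> < risk D l (out x))
      \<le> MoVE_bound (card \<Theta>) n k B (max_prob D R A \<Theta> k) (eta D R l A \<Theta> k \<delta>)"
    unfolding MoVE_bound_def .
  assume "4 / 5 < eta D R l A \<Theta> k \<delta>"
  then show "MoVE_bound (card \<Theta>) n k B (max_prob D R A \<Theta> k) (eta D R l A \<Theta> k \<delta>)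
      \<le> MoVE_simple_bound (exp 5) 80 30 (card \<Theta>) n k B
           (max_prob D R A \<Theta> k) (max_prob_bad D R l A \<Theta> k \<delta>)"
    using subsample_size max_prob_bad_nonneg max_prob_add_bad_le_1[OF gap]
    by (intro MoVE_bound_le_simple_bound) (auto simp: eta_def)
next
  fix N n k B :: nat and p q :: real
  assume "0 < k \<and> k \<le> n \<and> 0 \<le> q \<and> p + q \<le> 1 \<and> 4 / 5 < p - q"
  then show "MoVE_bound N n k B p (p - q) \<le> MoVE_simple_bound (exp 5) 80 30 N n k B p q"
    by (intro MoVE_bound_le_simple_bound) auto
qed

end
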